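(* Let $\rho_{\bar i}$ be a pure state relative to frame $R_i$ in orientation $g_i$, and let $\rho_{\bar j}=\hat V_{i\to j}^{g_i,g_j}(\rho_{\bar i})$ be the corresponding state relative to frame $R_j$ in orientation $g_j$. Then the $\alpha$-Rényi entropies of the $S$-subsystem states $\rho_{S|R_i}=\mathrm{Tr}_j(\rho_{\bar i})$ and $\rho_{S|R_j}=\mathrm{Tr}_i(\rho_{\bar j})$ in the two frame perspectives are the same for any value of $\alpha$, i.e. $$S_\alpha[\rho_{S|R_i}]=S_\alpha[\rho_{S|R_j}]\qquad\forall\,\alpha\in(0,1)\cup(1,\infty),\qquad S_\alpha[\rho]=\tfrac1{1-\alpha}\log\bigl(\mathrm{Tr}(\rho^\alpha)\bigr),$$ if and only if $\rho_{\bar i}\in\mathcal A_{\bar i}^{X}$ for some bilocal unitary $X=Y_j\otimes Z_S$. In other words, the entanglement spectrum agrees in both perspectives if and only if the global state lies in a TPS-invariant subalgebra.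
   Context: $\mathcal G$ is a finite abelian group, $\mathcal G\neq\{e\}$. For $i=1,2$ (two ideal quantum reference frames $R_1,R_2$), $\mathcal H_i=\ell^2(\mathcal G)$ has orthonormal basis $\{|g\rangle_i\}_{g\in\mathcal G}$. $\mathcal H_S$ is a (possibly infinite-dimensional) complex Hilbert space carrying a unitary representation $g\mapsto U_S^g$ of $\mathcal G$. For $i\neq j$ in $\{1,2\}$, $\mathcal H_{\bar i}=\mathcal H_j\otimes\mathcal H_S$ (the description of $R_j$ and $S$ relative to $R_i$) and $\mathcal A_{\bar i}$ is the algebra of (bounded) linear operators on it. For a unitary $W$ write $\hat W(A)=WAW^\dagger$ and $\hat W^\dagger(A)=W^\dagger AW$. The frame change is the unitary $V_{i\to j}^{g_i,g_j}=\sum_{g\in\mathcal G}|gg_i\rangle_i\otimes\langle g_jg^{-1}|_j\otimes U_S^g:\mathcal H_{\bar i}\to\mathcal H_{\bar j}$. Let $\mathbf U_{\bar i}^{g_i,g_j}=\sum_{g\in\mathcal G}|g_ig\rangle\langle g_jg^{-1}|_j\otimes U_S^g$ on $\mathcal H_{\bar i}$. For a bilocal unitary $X=Y_j\otimes Z_S$, the TPS-invariant subalgebra is $\mathcal A_{\bar i}^{X}=\{f\in\mathcal A_{\bar i}:\hat{\mathbf U}_{\bar i}^{g_i,g_j}(f)=\hat X^\dagger(f)\}$. *)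

theory Defs
  imports "HOL-Analysis.Analysis"
begin

section \<open>Complex Hilbert spaces\<close>

text \<open>A complex Hilbert space is a Banach space whose norm comes from a sesquilinear form,
  conjugate-linear in the first argument (the bra-ket convention).\<close>

class complex_hilbert_space = banach +
  fixes scaleC :: "complex \<Rightarrow> 'a \<Rightarrow> 'a" (infixr "*\<^sub>C" 75)
    and cinner :: "'a \<Rightarrow> 'a \<Rightarrow> complex"
  assumes scaleC_add_right: "c *\<^sub>C (x + y) = c *\<^sub>C x + c *\<^sub>C y"
    and scaleC_add_left: "(c + d) *\<^sub>C x = c *\<^sub>C x + d *\<^sub>C x"
    and scaleC_scaleC: "c *\<^sub>C d *\<^sub>C x = (c * d) *\<^sub>C x"
    and scaleC_one: "1 *\<^sub>C x = x"
    and scaleR_scaleC: "r *\<^sub>R x = complex_of_real r *\<^sub>C x"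
    and cinner_commute: "cinner x y = cnj (cinner y x)"
    and cinner_add_right: "cinner x (y + z) = cinner x y + cinner x z"
    and cinner_scaleC_right: "cinner x (c *\<^sub>C y) = c * cinner x y"
    and cinner_self: "cinner x x = complex_of_real ((norm x)\<^sup>2)"

instantiation complex :: complex_hilbert_space
begin

definition scaleC_complex :: "complex \<Rightarrow> complex \<Rightarrow> complex"
  where "scaleC_complex c x = c * x"

definition cinner_complex :: "complex \<Rightarrow> complex \<Rightarrow> complex"
  where "cinner_complex x y = cnj x * y"

instance
  by standard
    (simp_all add: scaleC_complex_def cinner_complex_def algebra_simps scaleR_conv_of_real
      complex_norm_square[symmetric] mult.commute[of "cnj _"])

end

instantiation vec :: (complex_hilbert_space, finite) complex_hilbert_space
begin

definition scaleC_vec :: "complex \<Rightarrow> 'a ^ 'b \<Rightarrow> 'a ^ 'b"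
  where "scaleC_vec c x = (\<chi> i. c *\<^sub>C (x $ i))"

definition cinner_vec :: "'a ^ 'b \<Rightarrow> 'a ^ 'b \<Rightarrow> complex"
  where "cinner_vec x y = (\<Sum>i\<in>UNIV. cinner (x $ i) (y $ i))"

instance
proof
  fix c d :: complex and r :: real and x y z :: "'a ^ 'b"
  show "c *\<^sub>C (x + y) = c *\<^sub>C x + c *\<^sub>C y"
    and "(c + d) *\<^sub>C x = c *\<^sub>C x + d *\<^sub>C x"
    and "c *\<^sub>C d *\<^sub>C x = (c * d) *\<^sub>C x"
    and "1 *\<^sub>C x = x"
    and "r *\<^sub>R x = complex_of_real r *\<^sub>C x"
    by (simp_all add: scaleC_vec_def vec_eq_iff scaleC_add_right scaleC_add_left
        scaleC_scaleC scaleC_one scaleR_scaleC)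
  show "cinner x y = cnj (cinner y x)"
    unfolding cinner_vec_def cnj_sum by (intro sum.cong refl cinner_commute)
  show "cinner x (y + z) = cinner x y + cinner x z"
    by (simp add: cinner_vec_def cinner_add_right sum.distrib)
  show "cinner x (c *\<^sub>C y) = c * cinner x y"
    by (simp add: cinner_vec_def scaleC_vec_def cinner_scaleC_right sum_distrib_left)
  show "cinner x x = complex_of_real ((norm x)\<^sup>2)"
    by (simp add: cinner_vec_def cinner_self norm_vec_def L2_set_def sum_nonneg)
qed

end

interpretation complex_vector:
  vector_space "scaleC :: complex \<Rightarrow> 'a \<Rightarrow> 'a::complex_hilbert_space"
  by unfold_locales
    (simp_all add: scaleC_add_right scaleC_add_left scaleC_scaleC scaleC_one)

section \<open>Operators\<close>

definition bounded_clinear ::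
    "('a::complex_hilbert_space \<Rightarrow> 'b::complex_hilbert_space) \<Rightarrow> bool"
  where "bounded_clinear A \<longleftrightarrow>
    bounded_linear A \<and> (\<forall>c x. A (c *\<^sub>C x) = c *\<^sub>C A x)"

definition cadjoint ::
    "('a::complex_hilbert_space \<Rightarrow> 'b::complex_hilbert_space) \<Rightarrow> 'b \<Rightarrow> 'a"
  where "cadjoint A = (THE B. \<forall>x y. cinner (A x) y = cinner x (B y))"

definition unitary ::
    "('a::complex_hilbert_space \<Rightarrow> 'b::complex_hilbert_space) \<Rightarrow> bool"
  where "unitary W \<longleftrightarrow>
    bounded_clinear W \<and> surj W \<and> (\<forall>x y. cinner (W x) (W y) = cinner x y)"

text \<open>\<open>conjugate_by W A\<close> is $\hat W(A) = W A W^\dagger$.\<close>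

definition conjugate_by ::
    "('a::complex_hilbert_space \<Rightarrow> 'b::complex_hilbert_space) \<Rightarrow> ('a \<Rightarrow> 'a) \<Rightarrow> 'b \<Rightarrow> 'b"
  where "conjugate_by W A = W \<circ> A \<circ> cadjoint W"

text \<open>\<open>ketbra x y\<close> is $|x\rangle\langle y|$.\<close>

definition ketbra ::
    "'a::complex_hilbert_space \<Rightarrow> 'b::complex_hilbert_space \<Rightarrow> 'b \<Rightarrow> 'a"
  where "ketbra x y = (\<lambda>z. cinner y z *\<^sub>C x)"

definition pure_state :: "('a::complex_hilbert_space \<Rightarrow> 'a) \<Rightarrow> bool"
  where "pure_state \<rho> \<longleftrightarrow> (\<exists>\<psi>. norm \<psi> = 1 \<and> \<rho> = ketbra \<psi> \<psi>)"

definition orthonormal_basis :: "'a::complex_hilbert_space set \<Rightarrow> bool"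
  where "orthonormal_basis B \<longleftrightarrow>
    (\<forall>b\<in>B. norm b = 1) \<and> (\<forall>b\<in>B. \<forall>c\<in>B. b \<noteq> c \<longrightarrow> cinner b c = 0) \<and>
    (\<forall>x. (\<forall>b\<in>B. cinner b x = 0) \<longrightarrow> x = 0)"

text \<open>For trace-class operators the sum does not depend on the orthonormal basis.\<close>

definition trace :: "('a::complex_hilbert_space \<Rightarrow> 'a) \<Rightarrow> complex"
  where "trace A = (\<Sum>\<^sub>\<infinity>b\<in>(SOME B. orthonormal_basis B). cinner b (A b))"

definition eigenspace :: "('a::complex_hilbert_space \<Rightarrow> 'a) \<Rightarrow> real \<Rightarrow> 'a set"
  where "eigenspace A \<mu> = {x. A x = complex_of_real \<mu> *\<^sub>C x}"

definition orthogonal_projection :: "'a::complex_hilbert_space set \<Rightarrow> 'a \<Rightarrow> 'a"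
  where "orthogonal_projection M x = (THE p. p \<in> M \<and> (\<forall>m\<in>M. cinner m (x - p) = 0))"

text \<open>Functional calculus $\rho^\alpha = \sum_{\mu > 0} \mu^\alpha P_\mu$ (for
  $\alpha > 0$) of a positive compact operator, such as a density operator; $P_\mu$ is the
  projection onto the $\mu$-eigenspace.\<close>

definition op_powr :: "('a::complex_hilbert_space \<Rightarrow> 'a) \<Rightarrow> real \<Rightarrow> 'a \<Rightarrow> 'a"
  where "op_powr \<rho> \<alpha> x = (\<Sum>\<^sub>\<infinity>\<mu> | 0 < \<mu> \<and> eigenspace \<rho> \<mu> \<noteq> {0}.
    complex_of_real (\<mu> powr \<alpha>) *\<^sub>C orthogonal_projection (eigenspace \<rho> \<mu>) x)"

definition renyi_entropy :: "real \<Rightarrow> ('a::complex_hilbert_space \<Rightarrow> 'a) \<Rightarrow> real"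
  where "renyi_entropy \<alpha> \<rho> = 1 / (1 - \<alpha>) * ln (Re (trace (op_powr \<rho> \<alpha>)))"

text \<open>The entanglement spectrum of a reduced state is its family of nonzero eigenvalues counted
  with multiplicity, given here as the multiplicity function.\<close>

definition entanglement_spectrum :: "('a::complex_hilbert_space \<Rightarrow> 'a) \<Rightarrow> real \<Rightarrow> nat"
  where "entanglement_spectrum \<rho> \<mu> =
    (if 0 < \<mu> then complex_vector.dim (eigenspace \<rho> \<mu>) else 0)"

section \<open>Bipartite systems\<close>

text \<open>For a finite index type \<open>'g\<close>, the space $\ell^2(\mathcal G)$ is \<open>complex ^ 'g\<close>, and
  $\ell^2(\mathcal G) \otimes \mathcal H_S$ is realised as \<open>'s ^ 'g\<close>, where
  $\Psi = \sum_g |g\rangle \otimes \Psi_g$.\<close>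

definition ket :: "'g::finite \<Rightarrow> complex ^ 'g"
  where "ket g = axis g 1"

definition tensor_vec :: "complex ^ 'g \<Rightarrow> 's::complex_hilbert_space \<Rightarrow> 's ^ 'g::finite"
  where "tensor_vec x \<phi> = (\<chi> g. (x $ g) *\<^sub>C \<phi>)"

text \<open>\<open>bra_apply x\<close> is $\langle x| \otimes 1_S$.\<close>

definition bra_apply :: "complex ^ 'g \<Rightarrow> 's ^ 'g::finite \<Rightarrow> 's::complex_hilbert_space"
  where "bra_apply x \<Psi> = (\<Sum>g\<in>UNIV. cnj (x $ g) *\<^sub>C (\<Psi> $ g))"

definition tensor_op ::
    "(complex ^ 'g \<Rightarrow> complex ^ 'h) \<Rightarrow> ('s \<Rightarrow> 't) \<Rightarrow>
      's::complex_hilbert_space ^ 'g::finite \<Rightarrow> 't::complex_hilbert_space ^ 'h::finite"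
  where "tensor_op Y Z \<Psi> = (\<Sum>g\<in>UNIV. tensor_vec (Y (ket g)) (Z (bra_apply (ket g) \<Psi>)))"

lemma cinner_tensor_vec:
  "cinner (tensor_vec x \<phi>) (tensor_vec y \<psi>) = cinner x y * cinner \<phi> \<psi>"
proof -
  have left: "cinner (c *\<^sub>C u) v = cnj c * cinner u v"
    for c and u v :: "'a::complex_hilbert_space"
    by (metis cinner_commute cinner_scaleC_right complex_cnj_mult)
  show ?thesis
    by (simp add: cinner_vec_def tensor_vec_def left cinner_scaleC_right cinner_complex_def
        sum_distrib_left ac_simps)
qed

lemma bra_apply_ket: "bra_apply (ket g) \<Psi> = \<Psi> $ g"
proof -
  have "bra_apply (ket g) \<Psi> = (\<Sum>h\<in>UNIV. if h = g then \<Psi> $ h else 0)"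
    unfolding bra_apply_def ket_def
    by (intro sum.cong) (auto simp: axis_def scaleC_one)
  then show ?thesis by simp
qed

lemma tensor_op_tensor_vec:
  assumes "bounded_clinear Y" "bounded_clinear Z"
  shows "tensor_op Y Z (tensor_vec x \<phi>) = tensor_vec (Y x) (Z \<phi>)"
proof -
  have x: "x = (\<Sum>g\<in>UNIV. x $ g *\<^sub>C ket g)"
    by (simp add: vec_eq_iff ket_def axis_def scaleC_vec_def scaleC_complex_def if_distrib
        cong: if_cong)
  have "Y x = (\<Sum>g\<in>UNIV. x $ g *\<^sub>C Y (ket g))"
    using assms(1) unfolding bounded_clinear_def
    by (subst x) (simp add: linear_sum bounded_linear.linear)
  moreover have "tensor_op Y Z (tensor_vec x \<phi>) =
      (\<Sum>g\<in>UNIV. tensor_vec (Y (ket g)) (x $ g *\<^sub>C Z \<phi>))"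
    using assms(2) by (simp add: tensor_op_def bra_apply_ket bounded_clinear_def tensor_vec_def)
  ultimately show ?thesis
    by (simp add: tensor_vec_def vec_eq_iff scaleC_vec_def scaleC_complex_def
        scaleC_scaleC complex_vector.scale_sum_left mult.commute)
qed

definition partial_trace ::
    "('s::complex_hilbert_space ^ 'g::finite \<Rightarrow> 's ^ 'g) \<Rightarrow> 's \<Rightarrow> 's"
  where "partial_trace \<rho> \<phi> = (\<Sum>g\<in>UNIV. bra_apply (ket g) (\<rho> (tensor_vec (ket g) \<phi>)))"

definition bilocal_unitary ::
    "('s::complex_hilbert_space ^ 'g::finite \<Rightarrow> 's ^ 'g) \<Rightarrow> bool"
  where "bilocal_unitary X \<longleftrightarrow> (\<exists>Y Z. unitary Y \<and> unitary Z \<and> X = tensor_op Y Z)"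

section \<open>Quantum reference frames\<close>

text \<open>The group is written additively: $g h$ is \<open>g + h\<close> and $g h^{-1}$ is \<open>g - h\<close>.\<close>

definition unitary_representation ::
    "('g::ab_group_add \<Rightarrow> 's::complex_hilbert_space \<Rightarrow> 's) \<Rightarrow> bool"
  where "unitary_representation U \<longleftrightarrow>
    (\<forall>g. unitary (U g)) \<and> U 0 = id \<and> (\<forall>g h. U (g + h) = U g \<circ> U h)"

text \<open>Both frames carry the same space $\ell^2(\mathcal G)$, so $\mathcal H_{\bar i}$ and
  $\mathcal H_{\bar j}$ are both \<open>'s ^ 'g\<close>: in the domain of \<open>frame_change\<close> the first tensor
  factor belongs to $R_j$, in the codomain to $R_i$.\<close>

definition frame_change ::
    "('g::{finite,ab_group_add} \<Rightarrow> 's::complex_hilbert_space \<Rightarrow> 's) \<Rightarrow> 'g \<Rightarrow> 'g \<Rightarrow>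
      ('s, 'g) vec \<Rightarrow> ('s, 'g) vec"
  where "frame_change U g\<^sub>i g\<^sub>j \<Psi> =
    (\<Sum>g\<in>UNIV. tensor_vec (ket (g + g\<^sub>i)) (U g (bra_apply (ket (g\<^sub>j - g)) \<Psi>)))"

definition frame_unitary ::
    "('g::{finite,ab_group_add} \<Rightarrow> 's::complex_hilbert_space \<Rightarrow> 's) \<Rightarrow> 'g \<Rightarrow> 'g \<Rightarrow>
      ('s, 'g) vec \<Rightarrow> ('s, 'g) vec"
  where "frame_unitary U g\<^sub>i g\<^sub>j \<Psi> =
    (\<Sum>g\<in>UNIV. tensor_op (ketbra (ket (g\<^sub>i + g)) (ket (g\<^sub>j - g))) (U g) \<Psi>)"

definition tps_invariant_subalgebra ::
    "('g::{finite,ab_group_add} \<Rightarrow> 's::complex_hilbert_space \<Rightarrow> 's) \<Rightarrow> 'g \<Rightarrow> 'g \<Rightarrow>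
      (('s, 'g) vec \<Rightarrow> ('s, 'g) vec) \<Rightarrow> (('s, 'g) vec \<Rightarrow> ('s, 'g) vec) set"
  where "tps_invariant_subalgebra U g\<^sub>i g\<^sub>j X =
    {f. bounded_clinear f \<and>
      conjugate_by (frame_unitary U g\<^sub>i g\<^sub>j) f = cadjoint X \<circ> f \<circ> X}"

end

theory Submission
  imports Defs
begin

text \<open>For \<open>\<rho> = |\<Psi>\<rangle>\<langle>\<Psi>|\<close> a Schmidt decomposition \<open>\<Psi> = \<Sum>\<^sub>g e\<^sub>g \<otimes> a\<^sub>g\<close>, with \<open>(e\<^sub>g)\<close> an orthonormal
  basis of \<open>\<ell>\<^sup>2(\<G>)\<close> and \<open>(a\<^sub>g)\<close> an orthogonal family, gives the reduced state \<open>\<Sum>\<^sub>g |a\<^sub>g\<rangle>\<langle>a\<^sub>g|\<close>. Its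
  positive spectrum consists of the positive weights \<open>p\<^sub>g = \<parallel>a\<^sub>g\<parallel>\<^sup>2\<close>, and its Renyi entropies are
  determined by the power sums \<open>\<Sum>\<^sub>g p\<^sub>g\<^sup>\<alpha>\<close>; the integer exponents \<open>\<alpha> \<ge> 2\<close> already determine the
  multiplicities. The frame change \<open>V\<close> and the unitary that defines the invariant subalgebra are the
  same map once the two frame spaces are identified, so \<open>\<rho>\<close> lies in the subalgebra of \<open>X\<close> iff
  \<open>V \<Psi> = X\<^sup>\<dagger> \<Psi>\<close> up to a phase. A bilocal \<open>X\<close> with this property exists iff the Schmidt weights of \<open>\<Psi>\<close>
  and \<open>V \<Psi>\<close> agree up to a permutation: orthogonal families with equal norms are matched, one vector
  at a time, by unitaries that are rank-one perturbations of the identity.\<close>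

section \<open>Inner products and unitary operators\<close>

lemma cinner_add_left: "cinner (x + y) z = cinner x z + cinner y z"
  by (metis cinner_add_right cinner_commute complex_cnj_add)

lemma cinner_scaleC_left: "cinner (c *\<^sub>C x) y = cnj c * cinner x y"
  by (metis cinner_commute cinner_scaleC_right complex_cnj_mult)

lemma cinner_zero_right [simp]: "cinner x 0 = 0"
  using cinner_add_right[of x 0 0] by simp

lemma cinner_zero_left [simp]: "cinner 0 x = 0"
  using cinner_add_left[of 0 0 x] by simp

lemma cinner_minus_right: "cinner x (- y) = - cinner x y"
  using cinner_add_right[of x y "- y"] by (simp add: eq_neg_iff_add_eq_0 add.commute)

lemma cinner_minus_left: "cinner (- x) y = - cinner x y"
  using cinner_add_left[of x "- x" y] by (simp add: eq_neg_iff_add_eq_0 add.commute)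

lemma cinner_diff_right: "cinner x (y - z) = cinner x y - cinner x z"
  using cinner_add_right[of x y "- z"] by (simp add: cinner_minus_right)

lemma cinner_diff_left: "cinner (x - y) z = cinner x z - cinner y z"
  using cinner_add_left[of x "- y" z] by (simp add: cinner_minus_left)

lemma cinner_sum_right: "cinner x (\<Sum>i\<in>I. f i) = (\<Sum>i\<in>I. cinner x (f i))"
  by (induction I rule: infinite_finite_induct) (simp_all add: cinner_add_right)

lemma cinner_sum_left: "cinner (\<Sum>i\<in>I. f i) x = (\<Sum>i\<in>I. cinner (f i) x)"
  by (induction I rule: infinite_finite_induct) (simp_all add: cinner_add_left)

lemmas cinner_simps = cinner_add_left cinner_add_right cinner_diff_left cinner_diff_right
  cinner_minus_left cinner_minus_right cinner_scaleC_left cinner_scaleC_right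
  cinner_sum_left cinner_sum_right

lemma cinner_self_eq_0_iff [simp]: "cinner x x = 0 \<longleftrightarrow> x = 0"
  by (simp add: cinner_self)

lemma norm_power2_cinner: "(norm x)\<^sup>2 = Re (cinner x x)"
  by (simp add: cinner_self)

lemma norm_scaleC: "norm (c *\<^sub>C x) = cmod c * norm x"
proof -
  have "complex_of_real ((norm (c *\<^sub>C x))\<^sup>2) = cnj c * (c * cinner x x)"
    by (simp only: cinner_self[symmetric] cinner_scaleC_left cinner_scaleC_right mult.left_commute)
  also have "\<dots> = complex_of_real ((cmod c * norm x)\<^sup>2)"
    using complex_norm_square[of c] by (simp add: cinner_self power_mult_distrib)
  finally have "(norm (c *\<^sub>C x))\<^sup>2 = (cmod c * norm x)\<^sup>2"
    using of_real_eq_iff by blast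
  then show ?thesis by simp
qed

lemma cinner_eqI:
  assumes "\<And>z. cinner z x = cinner z y"
  shows "x = y"
proof -
  have "cinner (x - y) (x - y) = 0"
    by (subst cinner_diff_right) (simp add: assms)
  then show ?thesis by simp
qed

lemma norm_diff_power2:
  "(norm (x - y))\<^sup>2 = (norm x)\<^sup>2 + (norm y)\<^sup>2 - 2 * Re (cinner x y)"
proof -
  have "Re (cinner y x) = Re (cinner x y)"
    by (metis cinner_commute complex_cnj_cnj cnj.sel(1))
  then show ?thesis
    by (simp add: norm_power2_cinner cinner_simps)
qed

lemma Cauchy_Schwarz: "cmod (cinner x y) \<le> norm x * norm y"
proof (cases "y = 0")
  case False
  \<comment> \<open>With this coefficient \<open>c *\<^sub>C y\<close> is the orthogonal projection
    of \<open>x\<close> onto the line of \<open>y\<close>; the squared length of the remainder is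
    nonnegative, which is the inequality.\<close>
  define c where "c = cinner y x / complex_of_real ((norm y)\<^sup>2)"
  have "0 \<le> (norm (x - c *\<^sub>C y))\<^sup>2" by simp
  also have "\<dots> = (norm x)\<^sup>2 + (cmod c * norm y)\<^sup>2 - 2 * Re (c * cinner x y)"
    by (simp add: norm_diff_power2 norm_scaleC cinner_scaleC_right)
  also have "c * cinner x y = complex_of_real ((cmod (cinner x y))\<^sup>2 / (norm y)\<^sup>2)"
    using complex_norm_square[of "cinner x y"]
    by (simp add: c_def cinner_commute[of y x] mult.commute)
  also have "cmod c = cmod (cinner x y) / (norm y)\<^sup>2"
    by (simp add: c_def norm_divide cinner_commute[of y x] norm_power)
  finally have "(cmod (cinner x y))\<^sup>2 \<le> (norm x * norm y)\<^sup>2"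
    using False by (simp add: field_simps power2_eq_square)
  then show ?thesis
    by (rule power2_le_imp_le) simp
qed simp

lemma bounded_linear_cinner_right: "bounded_linear (cinner (x :: 'a::complex_hilbert_space))"
  by (rule bounded_linear_intro[where K = "norm x"])
     (simp_all add: cinner_simps scaleR_scaleC[of _ "_ :: 'a"] scaleR_conv_of_real
       mult.commute[of _ "norm x"] Cauchy_Schwarz)

text \<open>Preserved inner products and surjectivity force linearity: \<open>W (x + y)\<close> and
  \<open>W x + W y\<close> have the same inner products with every \<open>W z\<close>, and the
  \<open>W z\<close> exhaust the space.\<close>

lemma unitary_iff: "unitary W \<longleftrightarrow> surj W \<and> (\<forall>x y. cinner (W x) (W y) = cinner x y)"
proof
  assume W: "surj W \<and> (\<forall>x y. cinner (W x) (W y) = cinner x y)"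
  have eqI: "u = v" if "\<And>z. cinner (W z) u = cinner (W z) v" for u v
    by (rule cinner_eqI) (metis W surjD that)
  have add: "W (x + y) = W x + W y" for x y
    by (rule eqI) (simp add: W cinner_simps)
  have scale: "W (c *\<^sub>C x) = c *\<^sub>C W x" for c x
    by (rule eqI) (simp add: W cinner_simps)
  have norm: "norm (W x) = norm x" for x
    by (metis W norm_ge_zero norm_power2_cinner power2_eq_imp_eq)
  have "bounded_linear W"
    by (rule bounded_linear_intro[where K = 1]) (simp_all add: add scale scaleR_scaleC norm)
  with W scale show "unitary W"
    by (simp add: unitary_def bounded_clinear_def)
qed (simp add: unitary_def)

lemma unitaryI:
  assumes "\<And>y. \<exists>x. W x = y" "\<And>x y. cinner (W x) (W y) = cinner x y"
  shows "unitary W"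
  using assms unfolding unitary_iff surj_def by metis

lemma
  assumes "unitary W"
  shows unitary_cinner: "cinner (W x) (W y) = cinner x y"
    and unitary_surj: "surj W"
    and unitary_scaleC: "W (c *\<^sub>C x) = c *\<^sub>C W x"
    and unitary_sum: "W (\<Sum>i\<in>I. f i) = (\<Sum>i\<in>I. W (f i))"
    and unitary_norm: "norm (W x) = norm x"
    and unitary_bounded_clinear: "bounded_clinear W"
proof -
  have lin: "bounded_linear W" and C: "\<And>c x. W (c *\<^sub>C x) = c *\<^sub>C W x"
    using assms by (auto simp: unitary_def bounded_clinear_def)
  show "cinner (W x) (W y) = cinner x y" "surj W" "bounded_clinear W"
    using assms by (auto simp: unitary_def)
  show "W (c *\<^sub>C x) = c *\<^sub>C W x" "W (\<Sum>i\<in>I. f i) = (\<Sum>i\<in>I. W (f i))"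
    using lin C by (auto simp: linear_sum bounded_linear.linear)
  show "norm (W x) = norm x"
    using assms by (intro power2_eq_imp_eq[OF _ norm_ge_zero norm_ge_zero])
      (simp add: norm_power2_cinner unitary_def)
qed

lemma unitary_inj: "unitary W \<Longrightarrow> inj W"
  by (rule injI, rule cinner_eqI) (metis unitary_cinner)

lemma unitary_inv_right: "unitary W \<Longrightarrow> W (inv W y) = y"
  by (simp add: unitary_surj surj_f_inv_f)

lemma unitary_inv_left: "unitary W \<Longrightarrow> inv W (W x) = x"
  by (simp add: unitary_inj)

lemma unitary_inv: "unitary W \<Longrightarrow> unitary (inv W)"
  using unitary_cinner[of W "inv W _" "inv W _"]
  by (intro unitaryI) (auto simp: unitary_inv_right intro: unitary_inv_left)

lemma unitary_comp: "unitary V \<Longrightarrow> unitary W \<Longrightarrow> unitary (V \<circ> W)"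
  by (simp add: unitary_iff comp_surj del: comp_apply) simp

lemma unitary_id: "unitary id"
  by (rule unitaryI) auto

text \<open>\<open>inv W\<close> solves the adjoint equation, and nondegeneracy of the inner product
  makes it the only solution, which settles the definite description.\<close>

lemma cadjoint_unitary:
  assumes "unitary W"
  shows "cadjoint W = inv W"
  unfolding cadjoint_def
proof (rule the_equality)
  show *: "\<forall>x y. cinner (W x) y = cinner x (inv W y)"
    using unitary_cinner[OF assms, of _ "inv W _"] unitary_inv_right[OF assms] by metis
  fix B assume "\<forall>x y. cinner (W x) y = cinner x (B y)"
  with * have "cinner x (B y) = cinner x (inv W y)" for x y
    by simp
  then show "B = inv W"
    by (intro ext) (rule cinner_eqI)
qed

lemma conjugate_ketbra:
  assumes "unitary W"
  shows "W \<circ> ketbra x y \<circ> inv W = ketbra (W x) (W y)"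
  using unitary_cinner[OF assms, of y "inv W _"]
  by (auto simp: ketbra_def unitary_scaleC[OF assms] unitary_inv_right[OF assms])

lemma bounded_clinear_ketbra: "bounded_clinear (ketbra x y)"
proof -
  have "bounded_linear (ketbra x y)"
  proof (rule bounded_linear_intro[where K = "norm x * norm y"])
    show "norm (ketbra x y z) \<le> norm z * (norm x * norm y)" for z
      using mult_right_mono[OF Cauchy_Schwarz[of y z], of "norm x"]
      by (simp add: ketbra_def norm_scaleC ac_simps)
  qed (simp_all add: ketbra_def cinner_simps scaleR_scaleC scaleC_add_left scaleC_scaleC)
  then show ?thesis
    by (simp add: bounded_clinear_def ketbra_def cinner_simps scaleC_scaleC)
qed

text \<open>With \<open>w = u - v\<close>, the map \<open>x \<mapsto> x - w \<langle>w, x\<rangle> / \<langle>w, u\<rangle>\<close> sends \<open>u\<close> to \<open>v\<close>; it is unitary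
  because \<open>norm u = norm v\<close> gives \<open>2 Re \<langle>w, u\<rangle> = \<langle>w, w\<rangle>\<close>.\<close>

lemma ex_unitary_mapping:
  assumes "norm u = norm v"
  obtains R where "unitary R" "R u = v"
    and "\<And>x. cinner u x = 0 \<Longrightarrow> cinner v x = 0 \<Longrightarrow> R x = x"
proof (cases "u = v")
  case True
  then show ?thesis
    by (intro that[of id]) (auto simp: unitary_id)
next
  case False
  define w where "w = u - v"
  define R where "R \<beta> x = x - (\<beta> * cinner w x) *\<^sub>C w" for \<beta> x
  define \<beta> where "\<beta> = 1 / cinner w u"
  have ww: "cinner w w = cinner w u + cnj (cinner w u)"
  proof -
    have "cinner u u = cinner v v"
      using assms by (simp add: cinner_self)
    then show ?thesis
      using cinner_commute[of u v] cinner_commute[of v v, symmetric]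
      by (simp add: w_def cinner_simps)
  qed
  have "cinner w w \<noteq> 0"
    using False by (simp add: w_def)
  then have nz: "cinner w u \<noteq> 0"
    using ww by auto
  have \<beta>: "\<beta> + cnj \<beta> = cnj \<beta> * \<beta> * cinner w w"
    using nz by (simp add: \<beta>_def ww divide_simps)
  have pres: "cinner (R \<beta> x) (R \<beta> y) = cinner x y" for x y
  proof -
    have "cinner (R \<beta> x) (R \<beta> y) =
        cinner x y + (cnj \<beta> * \<beta> * cinner w w - (\<beta> + cnj \<beta>)) * (cinner x w * cinner w y)"
      by (simp add: R_def cinner_simps cinner_commute[of x w] algebra_simps)
    then show ?thesis using \<beta> by simp
  qed
  \<comment> \<open>In infinite dimension an isometry need not be onto, so a right inverse is
    exhibited: the map of the same form with the conjugate coefficient.\<close>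
  have "R \<beta> (R (cnj \<beta>) y) = y" for y
  proof -
    have "R \<beta> (R (cnj \<beta>) y) =
        y + ((cnj \<beta> * \<beta> * cinner w w - (\<beta> + cnj \<beta>)) * cinner w y) *\<^sub>C w"
      by (simp add: R_def cinner_simps complex_vector.scale_left_diff_distrib
          complex_vector.scale_left_distrib algebra_simps)
    then show ?thesis using \<beta> by simp
  qed
  then have "unitary (R \<beta>)"
    using pres by (intro unitaryI) blast+
  moreover have "R \<beta> u = v"
    using nz by (simp add: R_def \<beta>_def scaleC_one) (simp add: w_def)
  moreover have "R \<beta> x = x" if "cinner u x = 0" "cinner v x = 0" for x
    using that by (simp add: R_def w_def cinner_simps)
  ultimately show ?thesis by (rule that)
qed

text \<open>Induction over the indices: \<open>R\<close> corrects the image of the new vector and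
  fixes the earlier \<open>b i\<close>, which are orthogonal to both \<open>Z (a k)\<close> and
  \<open>b k\<close>. Nothing is completed to a basis, so zero vectors and infinite dimension do no
  harm.\<close>

lemma ex_unitary_mapping_family:
  fixes a b :: "'i::finite \<Rightarrow> 'a::complex_hilbert_space"
  assumes "\<And>i j. i \<noteq> j \<Longrightarrow> cinner (a i) (a j) = 0"
    and "\<And>i j. i \<noteq> j \<Longrightarrow> cinner (b i) (b j) = 0"
    and "\<And>i. norm (a i) = norm (b i)"
  obtains Z where "unitary Z" "\<And>i. Z (a i) = b i"
proof -
  have "\<exists>Z. unitary Z \<and> (\<forall>i\<in>I. Z (a i) = b i)" for I
    using finite[of I]
  proof (induction I)
    case empty
    then show ?case using unitary_id by auto
  next
    case (insert k I)
    then obtain Z where Z: "unitary Z" "\<And>i. i \<in> I \<Longrightarrow> Z (a i) = b i"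
      by auto
    have "norm (Z (a k)) = norm (b k)"
      by (simp add: unitary_norm[OF Z(1)] assms(3))
    then obtain R where R: "unitary R" "R (Z (a k)) = b k"
      "\<And>x. cinner (Z (a k)) x = 0 \<Longrightarrow> cinner (b k) x = 0 \<Longrightarrow> R x = x"
      using ex_unitary_mapping by blast
    have "R (Z (a i)) = b i" if "i \<in> I" for i
    proof -
      have "k \<noteq> i" using that insert.hyps by auto
      then have "R (Z (a i)) = Z (a i)"
        using assms(2)[of k i] Z(2)[OF that] unitary_cinner[OF Z(1), of "a k" "a i"]
        by (intro R(3)) (simp_all add: assms(1))
      then show ?thesis using Z(2) that by simp
    qed
    then have "\<forall>i\<in>insert k I. (R \<circ> Z) (a i) = b i"
      using R(2) by simp
    with unitary_comp[OF R(1) Z(1)] show ?case by blast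
  qed
  from this[of UNIV] that show ?thesis by auto
qed

section \<open>Bipartite vectors\<close>

lemma ket_nth: "ket g $ h = (if h = g then 1 else 0)"
  by (simp add: ket_def axis_def)

lemma cinner_ket: "cinner (ket g) x = x $ g"
proof -
  have "cinner (ket g) x = (\<Sum>h\<in>UNIV. if h = g then x $ h else 0)"
    unfolding cinner_vec_def by (intro sum.cong) (simp_all add: ket_nth cinner_complex_def)
  then show ?thesis by simp
qed

lemma cinner_ket_ket: "cinner (ket g) (ket h) = (if g = h then 1 else 0)"
  by (simp add: cinner_ket ket_nth)

lemma norm_ket [simp]: "norm (ket g) = 1"
  using norm_power2_cinner[of "ket g"] by (simp add: cinner_ket_ket power2_eq_1_iff)
    (smt (verit) norm_ge_zero)

lemma vec_eq_sum_ket: "x = (\<Sum>g\<in>UNIV. x $ g *\<^sub>C ket g)"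
  by (simp add: vec_eq_iff ket_nth scaleC_vec_def scaleC_complex_def if_distrib cong: if_cong)

lemma tensor_vec_nth [simp]: "tensor_vec x \<phi> $ g = x $ g *\<^sub>C \<phi>"
  by (simp add: tensor_vec_def)

lemma bra_apply_add: "bra_apply (x + y) \<Psi> = bra_apply x \<Psi> + bra_apply y \<Psi>"
  by (simp add: bra_apply_def scaleC_add_left sum.distrib)

lemma bra_apply_scaleC: "bra_apply (c *\<^sub>C x) \<Psi> = cnj c *\<^sub>C bra_apply x \<Psi>"
  by (simp add: bra_apply_def scaleC_vec_def scaleC_complex_def complex_vector.scale_sum_right
      scaleC_scaleC)

lemma bra_apply_0 [simp]: "bra_apply 0 \<Psi> = 0"
  by (simp add: bra_apply_def)

lemma bra_apply_sum: "bra_apply (\<Sum>i\<in>I. f i) \<Psi> = (\<Sum>i\<in>I. bra_apply (f i) \<Psi>)"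
  by (induction I rule: infinite_finite_induct) (simp_all add: bra_apply_add)

lemma bounded_linear_scaleC_left: "bounded_linear (\<lambda>c. c *\<^sub>C x)"
  by (rule bounded_linear_intro[where K = "norm x"])
     (simp_all add: scaleC_add_left scaleR_scaleC scaleC_scaleC norm_scaleC scaleC_complex_def)

lemma continuous_on_bra_apply: "continuous_on S (\<lambda>x. bra_apply x \<Psi>)"
  unfolding bra_apply_def
  by (intro continuous_on_sum bounded_linear.continuous_on[OF bounded_linear_scaleC_left]
      continuous_intros)

lemma tensor_vec_sum_right: "tensor_vec x (\<Sum>i\<in>I. \<phi> i) = (\<Sum>i\<in>I. tensor_vec x (\<phi> i))"
  by (simp add: vec_eq_iff complex_vector.scale_sum_right)

lemma tensor_op_sum:
  assumes "unitary Z"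
  shows "tensor_op Y Z (\<Sum>i\<in>I. f i) = (\<Sum>i\<in>I. tensor_op Y Z (f i))"
  by (simp add: tensor_op_def bra_apply_ket unitary_sum[OF assms] tensor_vec_sum_right)
     (rule sum.swap)

text \<open>Preimages come from applying the inverses factorwise to the standard decomposition of
  \<open>\<Psi>\<close>; in the inner product, orthonormality of the \<open>Y (ket g)\<close> leaves
  only the diagonal terms.\<close>

lemma unitary_tensor_op:
  fixes Y :: "complex ^ 'g::finite \<Rightarrow> complex ^ 'g"
    and Z :: "'s \<Rightarrow> 's::complex_hilbert_space"
  assumes Y: "unitary Y" and Z: "unitary Z"
  shows "unitary (tensor_op Y Z)"
proof (rule unitaryI)
  fix \<Psi> :: "'s ^ 'g"
  have "tensor_op Y Z (\<Sum>h\<in>UNIV. tensor_vec (inv Y (ket h)) (inv Z (\<Psi> $ h))) =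
      (\<Sum>h\<in>UNIV. tensor_vec (ket h) (\<Psi> $ h))"
    by (simp add: tensor_op_sum[OF Z] tensor_op_tensor_vec unitary_bounded_clinear Y Z
        unitary_inv_right)
  also have "\<dots> = \<Psi>"
    by (simp add: vec_eq_iff ket_nth scaleC_one if_distrib[of "\<lambda>c. c *\<^sub>C _"] cong: if_cong)
  finally show "\<exists>\<Phi>. tensor_op Y Z \<Phi> = \<Psi>" ..
next
  fix \<Phi> \<Psi> :: "'s ^ 'g"
  have "cinner (tensor_op Y Z \<Phi>) (tensor_op Y Z \<Psi>) =
      (\<Sum>g\<in>UNIV. \<Sum>h\<in>UNIV. if h = g then cinner (\<Phi> $ h) (\<Psi> $ g) else 0)"
    unfolding tensor_op_def cinner_sum_left cinner_sum_right cinner_tensor_vec bra_apply_ket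
    by (intro sum.cong refl)
       (simp_all add: unitary_cinner[OF Y] unitary_cinner[OF Z] cinner_ket_ket)
  also have "\<dots> = cinner \<Phi> \<Psi>"
    by (simp add: cinner_vec_def)
  finally show "cinner (tensor_op Y Z \<Phi>) (tensor_op Y Z \<Psi>) = cinner \<Phi> \<Psi>" .
qed

section \<open>Schmidt decomposition\<close>

text \<open>First variation of the squared norm at a maximizer \<open>x\<close>, in the direction \<open>t s y\<close> with \<open>t > 0\<close> small and
  \<open>s\<close> the inner product to be shown zero: the gain \<open>2 t |s|\<^sup>2\<close> would beat every term of order \<open>t\<^sup>2\<close>.\<close>

lemma cinner_bra_apply_maximal:
  assumes max: "\<And>c. norm (bra_apply (x + c *\<^sub>C y) \<Psi>) \<le> norm (bra_apply x \<Psi>) * norm (x + c *\<^sub>C y)"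
    and x: "norm x = 1" and xy: "cinner x y = 0"
  shows "cinner (bra_apply x \<Psi>) (bra_apply y \<Psi>) = 0"
proof (rule ccontr)
  define s where "s = cinner (bra_apply x \<Psi>) (bra_apply y \<Psi>)"
  \<comment> \<open>\<open>K\<close> is the net coefficient of the second-order terms. After
    cancellation the variation inequality reads \<open>2 \<le> t * K\<close>, which the choice of
    \<open>t\<close> excludes.\<close>
  define K where "K = (norm (bra_apply x \<Psi>) * norm y)\<^sup>2 - (norm (bra_apply y \<Psi>))\<^sup>2"
  define t where "t = 1 / (1 + \<bar>K\<bar>)"
  assume "cinner (bra_apply x \<Psi>) (bra_apply y \<Psi>) \<noteq> 0"
  then have s: "(cmod s)\<^sup>2 > 0" by (simp add: s_def)
  have t: "t > 0" "t * K < 2"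
    by (auto simp: t_def field_simps add_pos_nonneg)
  define c where "c = t * s"
  have c: "cmod c = t * cmod s"
    using t by (simp add: c_def norm_mult)
  have add: "(norm (u + v))\<^sup>2 = (norm u)\<^sup>2 + (norm v)\<^sup>2 + 2 * Re (cinner u v)"
    for u v :: "'c::complex_hilbert_space"
    using norm_diff_power2[of u "- v"] by (simp add: cinner_minus_right)
  have "(norm (bra_apply (x + c *\<^sub>C y) \<Psi>))\<^sup>2 \<le> (norm (bra_apply x \<Psi>) * norm (x + c *\<^sub>C y))\<^sup>2"
    using max[of c] by (intro power_mono) auto
  moreover have "(norm (bra_apply (x + c *\<^sub>C y) \<Psi>))\<^sup>2 =
      (norm (bra_apply x \<Psi>))\<^sup>2 + (cmod c * norm (bra_apply y \<Psi>))\<^sup>2 + 2 * Re (cnj c * s)"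
    by (simp add: bra_apply_add bra_apply_scaleC add norm_scaleC cinner_scaleC_right s_def)
  moreover have "(norm (x + c *\<^sub>C y))\<^sup>2 = 1 + (cmod c * norm y)\<^sup>2"
    by (simp add: add norm_scaleC cinner_scaleC_right x xy)
  moreover have "Re (cnj c * s) = t * (cmod s)\<^sup>2"
    by (simp add: c_def cmod_def) (simp add: algebra_simps power2_eq_square)
  ultimately have "(cmod c * norm (bra_apply y \<Psi>))\<^sup>2 + 2 * (t * (cmod s)\<^sup>2) \<le>
      (norm (bra_apply x \<Psi>))\<^sup>2 * (cmod c * norm y)\<^sup>2"
    by (simp add: power_mult_distrib distrib_left)
  then have "2 * (t * (cmod s)\<^sup>2) \<le> (t * (cmod s)\<^sup>2) * (t * K)"
    by (simp add: c K_def power_mult_distrib algebra_simps power2_eq_square)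
  then have "2 \<le> t * K"
    using s t by (simp add: mult.commute[of 2])
  with t show False by simp
qed

text \<open>The unit vectors orthogonal to the given \<open>Y (ket i)\<close> form a compact subset
  of a finite-dimensional sphere, nonempty because it contains \<open>Y (ket k)\<close>. Rescaling
  turns maximality on the sphere into the homogeneous bound.\<close>

lemma ex_bra_apply_maximizer:
  fixes Y :: "complex ^ 'g::finite \<Rightarrow> complex ^ 'g" and \<Psi> :: "'s::complex_hilbert_space ^ 'g"
  assumes Y: "unitary Y" and k: "k \<notin> I"
  obtains x where "norm x = 1" "\<And>i. i \<in> I \<Longrightarrow> cinner (Y (ket i)) x = 0"
    "\<And>y. (\<And>i. i \<in> I \<Longrightarrow> cinner (Y (ket i)) y = 0) \<Longrightarrow>
      norm (bra_apply y \<Psi>) \<le> norm (bra_apply x \<Psi>) * norm y"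
proof -
  define S where "S = sphere (0 :: complex ^ 'g) 1 \<inter> (\<Inter>i\<in>I. {x. cinner (Y (ket i)) x = 0})"
  have "closed {x. cinner v x = 0}" for v :: "complex ^ 'g"
    by (intro closed_Collect_eq continuous_intros
        bounded_linear.continuous_on[OF bounded_linear_cinner_right])
  then have "compact S"
    unfolding S_def by (intro compact_Int_closed compact_sphere closed_INT) auto
  moreover have "Y (ket k) \<in> S"
    using k by (auto simp: S_def unitary_norm[OF Y] unitary_cinner[OF Y] cinner_ket_ket)
  moreover have "continuous_on S (\<lambda>x. norm (bra_apply x \<Psi>))"
    by (intro continuous_on_norm continuous_on_bra_apply)
  ultimately obtain x where x: "x \<in> S" "\<And>y. y \<in> S \<Longrightarrow> norm (bra_apply y \<Psi>) \<le> norm (bra_apply x \<Psi>)"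
    using continuous_attains_sup[of S] by blast
  have "norm (bra_apply y \<Psi>) \<le> norm (bra_apply x \<Psi>) * norm y"
    if y: "\<And>i. i \<in> I \<Longrightarrow> cinner (Y (ket i)) y = 0" for y
  proof (cases "y = 0")
    case False
    define c where "c = complex_of_real (1 / norm y)"
    have "c *\<^sub>C y \<in> S"
      using y False by (auto simp: S_def norm_scaleC cinner_scaleC_right c_def norm_divide)
    from x(2)[OF this] show ?thesis
      using False by (simp add: bra_apply_scaleC norm_scaleC c_def norm_divide field_simps)
  qed simp
  with x(1) show ?thesis
    by (intro that[of x]) (auto simp: S_def)
qed

text \<open>The Hermitian form given by the inner products of the vectors
  \<open>bra_apply x \<Psi>\<close> is diagonalized greedily: each new basis vector maximizes it on
  the unit sphere of the orthogonal complement of those already chosen.\<close>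

lemma ex_schmidt_basis:
  fixes \<Psi> :: "'s::complex_hilbert_space ^ 'g::finite"
  obtains Y :: "complex ^ 'g \<Rightarrow> complex ^ 'g" where "unitary Y"
    "\<And>g h. g \<noteq> h \<Longrightarrow> cinner (bra_apply (Y (ket g)) \<Psi>) (bra_apply (Y (ket h)) \<Psi>) = 0"
proof -
  \<comment> \<open>The invariant ranges over all \<open>y\<close> orthogonal to
    \<open>Y (ket i)\<close>, not just over basis vectors, so it survives when the later basis
    vectors are rotated.\<close>
  have "\<exists>Y. unitary Y \<and> (\<forall>i\<in>I. \<forall>y. cinner (Y (ket i)) y = 0 \<longrightarrow>
      cinner (bra_apply (Y (ket i)) \<Psi>) (bra_apply y \<Psi>) = 0)" for I :: "'g set"
    using finite[of I]
  proof (induction I)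
    case empty
    then show ?case using unitary_id by blast
  next
    case (insert k I)
    then obtain Y where Y: "unitary Y"
      and orth: "\<And>i y. i \<in> I \<Longrightarrow> cinner (Y (ket i)) y = 0 \<Longrightarrow>
        cinner (bra_apply (Y (ket i)) \<Psi>) (bra_apply y \<Psi>) = 0"
      by blast
    obtain x where x: "norm x = 1" "\<And>i. i \<in> I \<Longrightarrow> cinner (Y (ket i)) x = 0"
      and max: "\<And>y. (\<And>i. i \<in> I \<Longrightarrow> cinner (Y (ket i)) y = 0) \<Longrightarrow>
        norm (bra_apply y \<Psi>) \<le> norm (bra_apply x \<Psi>) * norm y"
      using ex_bra_apply_maximizer[OF Y insert.hyps(2)] by metis
    have "norm (Y (ket k)) = norm x"
      by (simp add: unitary_norm[OF Y] x)
    then obtain R where R: "unitary R" "R (Y (ket k)) = x"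
      "\<And>z. cinner (Y (ket k)) z = 0 \<Longrightarrow> cinner x z = 0 \<Longrightarrow> R z = z"
      using ex_unitary_mapping by blast
    have RY: "R (Y (ket i)) = Y (ket i)" if "i \<in> I" for i
      using that insert.hyps(2) x(2)[of i] cinner_commute[of x "Y (ket i)"]
      by (intro R(3)) (auto simp: unitary_cinner[OF Y] cinner_ket_ket)
    have "cinner (bra_apply x \<Psi>) (bra_apply y \<Psi>) = 0" if y: "cinner x y = 0" for y
    proof -
      \<comment> \<open>\<open>p\<close> is the projection of \<open>y\<close> onto the vectors
        chosen so far. Maximality of \<open>x\<close> covers \<open>y - p\<close>, and the invariant
        of the earlier vectors covers \<open>p\<close>.\<close>
      define p where "p = (\<Sum>i\<in>I. cinner (Y (ket i)) y *\<^sub>C Y (ket i))"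
      have "cinner (Y (ket i)) (y - p) = 0" if "i \<in> I" for i
      proof -
        have "cinner (Y (ket i)) p =
            (\<Sum>j\<in>I. if j = i then cinner (Y (ket j)) y else 0)"
          unfolding p_def cinner_sum_right
          by (intro sum.cong) (simp_all add: cinner_scaleC_right unitary_cinner[OF Y] cinner_ket_ket)
        then show ?thesis
          using that by (simp add: cinner_diff_right)
      qed
      moreover have xp: "cinner x p = 0"
        using x(2) cinner_commute[of x "Y (ket _)"]
        by (simp add: p_def cinner_sum_right cinner_scaleC_right)
      ultimately have "cinner (bra_apply x \<Psi>) (bra_apply (y - p) \<Psi>) = 0"
        using x y by (intro cinner_bra_apply_maximal max)
          (auto simp: cinner_add_right cinner_diff_right cinner_scaleC_right)
      moreover have "cinner (bra_apply x \<Psi>) (bra_apply p \<Psi>) = 0"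
        using orth x(2) cinner_commute[of "bra_apply x \<Psi>" "bra_apply (Y (ket _)) \<Psi>"]
        by (simp add: p_def bra_apply_sum bra_apply_scaleC cinner_sum_right cinner_scaleC_right)
      moreover have "bra_apply y \<Psi> = bra_apply (y - p) \<Psi> + bra_apply p \<Psi>"
        by (simp flip: bra_apply_add)
      ultimately show ?thesis
        by (simp add: cinner_add_right)
    qed
    then have "\<forall>i\<in>insert k I. \<forall>y. cinner ((R \<circ> Y) (ket i)) y = 0 \<longrightarrow>
        cinner (bra_apply ((R \<circ> Y) (ket i)) \<Psi>) (bra_apply y \<Psi>) = 0"
      using R(2) RY orth by auto
    with unitary_comp[OF R(1) Y] show ?case by blast
  qed
  from this[of UNIV] obtain Y :: "complex ^ 'g \<Rightarrow> complex ^ 'g" where "unitary Y"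
    "\<And>i y. cinner (Y (ket i)) y = 0 \<Longrightarrow> cinner (bra_apply (Y (ket i)) \<Psi>) (bra_apply y \<Psi>) = 0"
    by auto
  then show ?thesis
    by (intro that[of Y]) (auto simp: unitary_cinner cinner_ket_ket)
qed

text \<open>In the basis of the \<open>Y (ket g)\<close> the coefficients of \<open>ket h\<close>
  are the conjugated entries of \<open>Y\<close>; the bra is conjugate-linear and removes the
  conjugation.\<close>

lemma bra_apply_expansion:
  fixes Y :: "complex ^ 'g::finite \<Rightarrow> complex ^ 'g" and \<Psi> :: "'s::complex_hilbert_space ^ 'g"
  assumes Y: "unitary Y"
  shows "\<Psi> = (\<Sum>g\<in>UNIV. tensor_vec (Y (ket g)) (bra_apply (Y (ket g)) \<Psi>))"
proof -
  have "\<Psi> $ h = (\<Sum>g\<in>UNIV. Y (ket g) $ h *\<^sub>C bra_apply (Y (ket g)) \<Psi>)" for h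
  proof -
    have "inv Y (ket h) $ g = cnj (Y (ket g) $ h)" for g
      using unitary_cinner[OF Y, of "ket g" "inv Y (ket h)"] cinner_commute[of "Y (ket g)" "ket h"]
      by (simp add: unitary_inv_right[OF Y] cinner_ket)
    then have "inv Y (ket h) = (\<Sum>g\<in>UNIV. cnj (Y (ket g) $ h) *\<^sub>C ket g)"
      by (subst vec_eq_sum_ket) simp
    then have "Y (inv Y (ket h)) = (\<Sum>g\<in>UNIV. cnj (Y (ket g) $ h) *\<^sub>C Y (ket g))"
      by (simp only: unitary_sum[OF Y] unitary_scaleC[OF Y])
    then have "ket h = (\<Sum>g\<in>UNIV. cnj (Y (ket g) $ h) *\<^sub>C Y (ket g))"
      by (simp only: unitary_inv_right[OF Y])
    then have "bra_apply (ket h) \<Psi> = (\<Sum>g\<in>UNIV. Y (ket g) $ h *\<^sub>C bra_apply (Y (ket g)) \<Psi>)"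
      by (subst \<open>ket h = _\<close>) (simp add: bra_apply_sum bra_apply_scaleC)
    then show ?thesis by (simp add: bra_apply_ket)
  qed
  then show ?thesis by (simp add: vec_eq_iff)
qed

text \<open>The sum of the operators |a_i><a_i|, with the probabilities kept in the norms of the
  vectors. Orthogonality is left open, so that the components of a bipartite vector qualify as
  well.\<close>

definition ensemble_operator ::
    "('i::finite \<Rightarrow> 's::complex_hilbert_space) \<Rightarrow> 's \<Rightarrow> 's"
  where "ensemble_operator a \<phi> = (\<Sum>i\<in>UNIV. cinner (a i) \<phi> *\<^sub>C a i)"

lemma partial_trace_ketbra: "partial_trace (ketbra \<Psi> \<Psi>) = ensemble_operator (($) \<Psi>)"
proof
  fix \<phi>
  have "cinner \<Psi> (tensor_vec (ket g) \<phi>) = cinner (\<Psi> $ g) \<phi>" for g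
  proof -
    have "cinner \<Psi> (tensor_vec (ket g) \<phi>) = (\<Sum>h\<in>UNIV. if h = g then cinner (\<Psi> $ h) \<phi> else 0)"
      unfolding cinner_vec_def by (intro sum.cong) (auto simp: ket_nth scaleC_one)
    then show ?thesis by simp
  qed
  then show "partial_trace (ketbra \<Psi> \<Psi>) \<phi> = ensemble_operator (($) \<Psi>) \<phi>"
    by (simp add: partial_trace_def ketbra_def bra_apply_ket ensemble_operator_def scaleC_vec_def)
qed

text \<open>Ensembles related by a unitary mixing matrix define the same operator, and the matrix of
  \<open>Y\<close> turns the \<open>a g\<close> into the components of
  \<open>\<Psi>\<close>.\<close>

lemma partial_trace_schmidt:
  fixes Y :: "complex ^ 'g::finite \<Rightarrow> complex ^ 'g" and a :: "'g \<Rightarrow> 's::complex_hilbert_space"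
  assumes Y: "unitary Y" and \<Psi>: "\<Psi> = (\<Sum>g\<in>UNIV. tensor_vec (Y (ket g)) (a g))"
  shows "partial_trace (ketbra \<Psi> \<Psi>) = ensemble_operator a"
  unfolding partial_trace_ketbra
proof (rule ext, rule cinner_eqI)
  fix \<phi> \<eta>
  \<comment> \<open>\<open>v \<xi>\<close> lists the inner products of \<open>\<xi>\<close> with the
    \<open>a g\<close>. Matrix elements of both operators are inner products of such lists, before
    and after applying \<open>Y\<close>.\<close>
  define v where "v \<xi> = (\<chi> g. cinner \<xi> (a g))" for \<xi>
  have Yv: "Y (v \<xi>) $ h = cinner \<xi> (\<Psi> $ h)" for \<xi> h
  proof -
    have "Y (v \<xi>) = (\<Sum>g\<in>UNIV. v \<xi> $ g *\<^sub>C Y (ket g))"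
      by (subst vec_eq_sum_ket) (simp add: unitary_sum[OF Y] unitary_scaleC[OF Y])
    then show ?thesis
      by (simp add: \<Psi> v_def cinner_sum_right cinner_scaleC_right scaleC_vec_def
          scaleC_complex_def mult.commute)
  qed
  have "cinner \<eta> (ensemble_operator (($) \<Psi>) \<phi>) = cinner (Y (v \<phi>)) (Y (v \<eta>))"
    by (simp add: ensemble_operator_def cinner_sum_right cinner_scaleC_right cinner_vec_def
        cinner_complex_def Yv flip: cinner_commute)
  also have "\<dots> = cinner (v \<phi>) (v \<eta>)"
    by (rule unitary_cinner[OF Y])
  also have "\<dots> = cinner \<eta> (ensemble_operator a \<phi>)"
    by (simp add: ensemble_operator_def cinner_sum_right cinner_scaleC_right cinner_vec_def
        cinner_complex_def v_def flip: cinner_commute)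
  finally show "cinner \<eta> (ensemble_operator (($) \<Psi>) \<phi>) = cinner \<eta> (ensemble_operator a \<phi>)" .
qed

section \<open>The frame change\<close>

text \<open>In coordinates the frame change reflects the group index and acts on each component by
  one \<open>U g\<close>, since only \<open>g = k - g\<^sub>i\<close> contributes to component
  \<open>k\<close>.\<close>

lemma frame_change_nth:
  "frame_change U g\<^sub>i g\<^sub>j \<Psi> $ k = U (k - g\<^sub>i) (\<Psi> $ (g\<^sub>j + g\<^sub>i - k))"
proof -
  have "frame_change U g\<^sub>i g\<^sub>j \<Psi> $ k =
      (\<Sum>g\<in>UNIV. if g = k - g\<^sub>i then U g (\<Psi> $ (g\<^sub>j - g)) else 0)"
    unfolding frame_change_def sum_component tensor_vec_nth bra_apply_ket
    by (intro sum.cong) (auto simp: ket_nth scaleC_one eq_diff_eq)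
  then show ?thesis
    by (simp only: sum.delta finite UNIV_I if_True diff_diff_eq2)
qed

lemma tensor_op_ketbra_ket:
  "tensor_op (ketbra (ket x) (ket y)) W \<Psi> = tensor_vec (ket x) (W (\<Psi> $ y))"
proof -
  have "tensor_op (ketbra (ket x) (ket y)) W \<Psi> =
      (\<Sum>h\<in>UNIV. if h = y then tensor_vec (ket x) (W (\<Psi> $ h)) else 0)"
    unfolding tensor_op_def bra_apply_ket
    by (intro sum.cong) (auto simp: ketbra_def cinner_ket_ket scaleC_one tensor_vec_def vec_eq_iff)
  then show ?thesis by simp
qed

text \<open>Both frames are indexed by the same group, so the output kets differ only in the order
  of a commutative product.\<close>

lemma frame_unitary_eq_frame_change: "frame_unitary U g\<^sub>i g\<^sub>j = frame_change U g\<^sub>i g\<^sub>j"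
  by (intro ext)
     (simp add: frame_unitary_def frame_change_def tensor_op_ketbra_ket bra_apply_ket add.commute)

lemma unitary_frame_change:
  assumes "unitary_representation U"
  shows "unitary (frame_change U g\<^sub>i g\<^sub>j)"
proof (rule unitaryI)
  have U: "unitary (U g)" for g
    using assms by (simp add: unitary_representation_def)
  show "\<exists>\<Phi>. frame_change U g\<^sub>i g\<^sub>j \<Phi> = \<Psi>" for \<Psi>
    \<comment> \<open>The preimage solves the coordinate formula: for
      \<open>m = g\<^sub>j + g\<^sub>i - k\<close> the argument \<open>k - g\<^sub>i\<close> of
      \<open>U\<close> becomes \<open>g\<^sub>j - m\<close>.\<close>
    by (rule exI[of _ "\<chi> m. inv (U (g\<^sub>j - m)) (\<Psi> $ (g\<^sub>j + g\<^sub>i - m))"])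
       (simp add: vec_eq_iff frame_change_nth unitary_inv_right[OF U])
  show "cinner (frame_change U g\<^sub>i g\<^sub>j \<Phi>) (frame_change U g\<^sub>i g\<^sub>j \<Psi>) = cinner \<Phi> \<Psi>" for \<Phi> \<Psi>
    unfolding cinner_vec_def frame_change_nth unitary_cinner[OF U]
    by (rule sum.reindex_bij_witness[of _ "\<lambda>k. g\<^sub>j + g\<^sub>i - k" "\<lambda>k. g\<^sub>j + g\<^sub>i - k"]) auto
qed

section \<open>Orthonormal bases and the trace\<close>

definition orthonormal :: "'a::complex_hilbert_space set \<Rightarrow> bool"
  where "orthonormal B \<longleftrightarrow> (\<forall>b\<in>B. \<forall>c\<in>B. cinner b c = (if b = c then 1 else 0))"

lemma orthonormal_basis_iff:
  "orthonormal_basis B \<longleftrightarrow> orthonormal B \<and> (\<forall>x. (\<forall>b\<in>B. cinner b x = 0) \<longrightarrow> x = 0)"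
proof -
  have "norm b = 1 \<longleftrightarrow> cinner b b = 1" for b :: 'a
    by (simp add: cinner_self power2_eq_1_iff del: of_real_power) (smt (verit) norm_ge_zero)
  then show ?thesis
    unfolding orthonormal_basis_def orthonormal_def by auto
qed

text \<open>By Zorn there is a maximal orthonormal set; a nonzero vector orthogonal to all of it
  could be normalized and added. This gives meaning to the basis chosen in
  \<open>trace\<close>.\<close>

lemma ex_orthonormal_basis: "\<exists>B :: 'a::complex_hilbert_space set. orthonormal_basis B"
proof -
  have "\<exists>M\<in>Collect orthonormal. \<forall>X\<in>Collect orthonormal. M \<subseteq> X \<longrightarrow> X = (M :: 'a set)"
  proof (rule subset_Zorn')
    fix C :: "'a set set"
    assume C: "subset.chain (Collect orthonormal) C"
    have "cinner b c = (if b = c then 1 else 0)" if bc: "b \<in> \<Union>C" "c \<in> \<Union>C" for b c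
    proof -
      obtain X Y where X: "X \<in> C" "b \<in> X" and Y: "Y \<in> C" "c \<in> Y"
        using bc by blast
      then have "X \<subseteq> Y \<or> Y \<subseteq> X"
        using C by (auto simp: subset_chain_def)
      then obtain Z where "Z \<in> C" "b \<in> Z" "c \<in> Z"
        using X Y by blast
      moreover have "orthonormal Z"
        using C \<open>Z \<in> C\<close> by (auto simp: subset_chain_def)
      ultimately show ?thesis
        by (simp add: orthonormal_def)
    qed
    then show "\<Union>C \<in> Collect orthonormal"
      by (simp add: orthonormal_def)
  qed
  then obtain M :: "'a set" where M: "orthonormal M"
    and max: "\<And>X. orthonormal X \<Longrightarrow> M \<subseteq> X \<Longrightarrow> X = M"
    by blast
  have "x = 0" if x: "\<forall>b\<in>M. cinner b x = 0" for x
  proof (rule ccontr)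
    assume "x \<noteq> 0"
    define u where "u = complex_of_real (1 / norm x) *\<^sub>C x"
    have "norm u = 1"
      using \<open>x \<noteq> 0\<close> by (simp add: u_def norm_scaleC norm_divide)
    then have uu: "cinner u u = 1"
      by (simp add: cinner_self)
    have bu: "cinner b u = 0" if "b \<in> M" for b
      using x that by (simp add: u_def cinner_scaleC_right)
    moreover have "cinner u b = 0" if "b \<in> M" for b
      using bu[OF that] cinner_commute[of u b] by simp
    ultimately have "orthonormal (insert u M)"
      using M uu by (auto simp: orthonormal_def)
    then have "u \<in> M"
      using max[of "insert u M"] by blast
    then show False
      using bu[of u] uu by simp
  qed
  with M show ?thesis
    by (auto simp: orthonormal_basis_iff)
qed

lemma norm_sum_orthonormal:
  assumes "orthonormal F" "finite F"
  shows "(norm (\<Sum>b\<in>F. c b *\<^sub>C b))\<^sup>2 = (\<Sum>b\<in>F. (cmod (c b))\<^sup>2)"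
proof -
  have "cinner (\<Sum>b\<in>F. c b *\<^sub>C b) (\<Sum>b\<in>F. c b *\<^sub>C b) =
      (\<Sum>b\<in>F. \<Sum>d\<in>F. if d = b then c b * cnj (c b) else 0)"
    unfolding cinner_sum_left cinner_sum_right using assms(1)
    by (intro sum.cong refl) (simp add: cinner_scaleC_left cinner_scaleC_right orthonormal_def)
  also have "\<dots> = (\<Sum>b\<in>F. c b * cnj (c b))"
    using assms(2) by simp
  also have "\<dots> = complex_of_real (\<Sum>b\<in>F. (cmod (c b))\<^sup>2)"
    by (simp only: of_real_sum complex_norm_square)
  finally show ?thesis
    by (simp add: norm_power2_cinner del: of_real_sum)
qed

lemma Bessel:
  assumes "orthonormal F" "finite F"
  shows "(\<Sum>b\<in>F. (cmod (cinner b x))\<^sup>2) \<le> (norm x)\<^sup>2"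
proof -
  have "cinner x (\<Sum>b\<in>F. cinner b x *\<^sub>C b) = complex_of_real (\<Sum>b\<in>F. (cmod (cinner b x))\<^sup>2)"
    unfolding cinner_sum_right cinner_scaleC_right of_real_sum complex_norm_square
    by (simp flip: cinner_commute)
  then have "(norm (x - (\<Sum>b\<in>F. cinner b x *\<^sub>C b)))\<^sup>2 =
      (norm x)\<^sup>2 - (\<Sum>b\<in>F. (cmod (cinner b x))\<^sup>2)"
    using assms by (simp add: norm_diff_power2 norm_sum_orthonormal del: of_real_sum)
  then show ?thesis
    by (smt (verit) zero_le_power2)
qed

text \<open>Bessel makes the squared coefficients summable, Pythagoras turns their tails into tails
  of the vector series, and completeness supplies the limit.\<close>

lemma orthonormal_expansion_summable:
  fixes x :: "'a::complex_hilbert_space"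
  assumes B: "orthonormal B"
  shows "(\<lambda>b. cinner b x *\<^sub>C b) summable_on B"
proof -
  define r where "r b = (cmod (cinner b x))\<^sup>2" for b
  have sub: "orthonormal F" if "F \<subseteq> B" for F
    using B that unfolding orthonormal_def by blast
  have "r summable_on B"
  proof (rule nonneg_bdd_above_summable_on)
    show "bdd_above (sum r ` {F. F \<subseteq> B \<and> finite F})"
      unfolding r_def by (intro bdd_aboveI2[where M = "(norm x)\<^sup>2"] Bessel) (auto intro: sub)
  qed (simp add: r_def)
  then obtain L where L: "(r has_sum L) B"
    by (auto simp: summable_on_def)
  define f where "f b = cinner b x *\<^sub>C b" for b
  have "\<exists>P. eventually P (finite_subsets_at_top B) \<and>
      (\<forall>F G. P F \<and> P G \<longrightarrow> dist (sum f F) (sum f G) < e)" if e: "e > 0" for e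
  proof -
    \<comment> \<open>\<open>H\<close> misses at most \<open>(e / 3)\<^sup>2\<close> of the total,
      so two finite sets above \<open>H\<close> have partial sums within \<open>2 * e / 3\<close> of
      each other.\<close>
    obtain H where H: "finite H" "H \<subseteq> B" "dist (sum r H) L \<le> (e / 3)\<^sup>2"
      using has_sum_finite_approximation[OF L, of "(e / 3)\<^sup>2"] e by auto
    define P where "P F \<longleftrightarrow> finite F \<and> H \<subseteq> F \<and> F \<subseteq> B" for F
    have close: "dist (sum f F) (sum f H) \<le> e / 3" if "P F" for F
    proof -
      have F: "finite F" "H \<subseteq> F" "F \<subseteq> B"
        using that by (auto simp: P_def)
      have "(dist (sum f F) (sum f H))\<^sup>2 = (norm (sum f (F - H)))\<^sup>2"
        using F by (simp add: dist_norm sum_diff)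
      also have "\<dots> = sum r (F - H)"
        unfolding f_def r_def using F by (intro norm_sum_orthonormal sub) auto
      also have "\<dots> = sum r F - sum r H"
        using F by (simp add: sum_diff)
      also have "\<dots> \<le> (e / 3)\<^sup>2"
        using finite_sum_le_has_sum[OF L F(1,3)] H(3) by (simp add: r_def dist_real_def)
      finally show ?thesis
        using e by (simp add: abs_le_square_iff[symmetric])
    qed
    have "eventually P (finite_subsets_at_top B)"
      unfolding P_def eventually_finite_subsets_at_top using H by blast
    moreover have "dist (sum f F) (sum f G) < e" if "P F" "P G" for F G
      using dist_triangle2[of "sum f F" "sum f G" "sum f H"] close[OF that(1)] close[OF that(2)] e
      by linarith
    ultimately show ?thesis by blast
  qed
  then have "cauchy_filter (filtermap (sum f) (finite_subsets_at_top B))"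
    by (simp add: cauchy_filter_metric_filtermap)
  moreover have "complete (UNIV :: 'a set)"
    by (meson Cauchy_convergent UNIV_I complete_def convergent_def)
  ultimately obtain y where "(sum f \<longlongrightarrow> y) (finite_subsets_at_top B)"
    using complete_uniform[where S = UNIV] by (force simp add: filterlim_def)
  then show ?thesis
    unfolding summable_on_def has_sum_def f_def by blast
qed

text \<open>The limit of the series has the same coefficients as \<open>x\<close>, and totality of
  the basis identifies the two.\<close>

lemma orthonormal_basis_expansion:
  assumes B: "orthonormal_basis B"
  shows "((\<lambda>b. cinner b x *\<^sub>C b) has_sum x) B"
proof -
  have on: "orthonormal B" and tot: "\<And>z. (\<And>b. b \<in> B \<Longrightarrow> cinner b z = 0) \<Longrightarrow> z = 0"
    using B by (auto simp: orthonormal_basis_iff)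
  obtain y where y: "((\<lambda>b. cinner b x *\<^sub>C b) has_sum y) B"
    using orthonormal_expansion_summable[OF on] by (auto simp: summable_on_def)
  have "cinner b y = cinner b x" if b: "b \<in> B" for b
  proof -
    have "((\<lambda>c. cinner b (cinner c x *\<^sub>C c)) has_sum cinner b y) B"
      by (rule has_sum_bounded_linear[OF bounded_linear_cinner_right y])
    moreover have "((\<lambda>c. cinner b (cinner c x *\<^sub>C c)) has_sum cinner b x) B"
      using on b
      by (intro has_sum_finite_neutralI[where B = "{b}"])
         (auto simp: cinner_scaleC_right orthonormal_def)
    ultimately show ?thesis
      by (rule has_sum_unique)
  qed
  then have "y - x = 0"
    by (intro tot) (simp add: cinner_diff_right)
  with y show ?thesis by simp
qed

lemma Parseval:
  assumes "orthonormal_basis B"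
  shows "((\<lambda>b. cinner b x * cinner x b) has_sum cinner x x) B"
  using has_sum_bounded_linear[OF bounded_linear_cinner_right orthonormal_basis_expansion[OF assms]]
  by (simp add: cinner_scaleC_right)

text \<open>Parseval, applied to each rank-one term, gives the same value in every orthonormal
  basis, hence also in the one chosen by \<open>SOME\<close>.\<close>

lemma trace_rank_one_sum:
  fixes a :: "'i \<Rightarrow> 'a::complex_hilbert_space"
  assumes "finite I"
  shows "trace (\<lambda>x. \<Sum>i\<in>I. (c i * cinner (a i) x) *\<^sub>C a i) = (\<Sum>i\<in>I. c i * cinner (a i) (a i))"
proof -
  define B :: "'a set" where "B = (SOME B. orthonormal_basis B)"
  have B: "orthonormal_basis B"
    unfolding B_def by (rule someI_ex) (rule ex_orthonormal_basis)
  have "((\<lambda>b. \<Sum>i\<in>I. c i * (cinner b (a i) * cinner (a i) b)) has_sum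
      (\<Sum>i\<in>I. c i * cinner (a i) (a i))) B"
    using assms
    by (induction I) (simp_all add: has_sum_add has_sum_cmult_right Parseval[OF B])
  then show ?thesis
    unfolding trace_def B_def[symmetric]
    by (intro infsumI) (simp add: cinner_sum_right cinner_scaleC_right ac_simps)
qed

lemma ensemble_operator_add: "ensemble_operator a (x + y) = ensemble_operator a x + ensemble_operator a y"
  by (simp add: ensemble_operator_def cinner_add_right scaleC_add_left sum.distrib)

lemma ensemble_operator_scaleC: "ensemble_operator a (c *\<^sub>C x) = c *\<^sub>C ensemble_operator a x"
  by (simp add: ensemble_operator_def cinner_scaleC_right complex_vector.scale_sum_right)

section \<open>Spectrum of a sum of orthogonal rank-one operators\<close>

text \<open>Vectors may vanish: a Schmidt decomposition indexed by the whole group can contain zero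
  terms.\<close>

locale orthogonal_family =
  fixes a :: "'i::finite \<Rightarrow> 's::complex_hilbert_space"
  assumes orthogonal: "i \<noteq> j \<Longrightarrow> cinner (a i) (a j) = 0"
begin

definition weight :: "'i \<Rightarrow> real"
  where "weight i = (norm (a i))\<^sup>2"

text \<open>For \<open>\<mu> > 0\<close> this is the orthogonal projection onto the
  \<open>\<mu>\<close>-eigenspace; the division normalizes, because every vector in the sum has
  squared norm \<open>\<mu>\<close>.\<close>

definition component :: "real \<Rightarrow> 's \<Rightarrow> 's"
  where "component \<mu> x = (\<Sum>i | weight i = \<mu>. (cinner (a i) x / complex_of_real \<mu>) *\<^sub>C a i)"

lemma cinner_a: "cinner (a i) (a j) = (if i = j then complex_of_real (weight i) else 0)"
  by (simp add: orthogonal weight_def cinner_self)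

lemma cinner_a_sum:
  "cinner (a j) (\<Sum>i\<in>I. c i *\<^sub>C a i) = (if j \<in> I then c j * complex_of_real (weight j) else 0)"
proof -
  have "cinner (a j) (\<Sum>i\<in>I. c i *\<^sub>C a i) =
      (\<Sum>i\<in>I. if i = j then c i * complex_of_real (weight i) else 0)"
    unfolding cinner_sum_right by (intro sum.cong) (auto simp: cinner_scaleC_right cinner_a)
  then show ?thesis by simp
qed

lemma ensemble_operator_sum:
  "ensemble_operator a (\<Sum>i\<in>I. c i *\<^sub>C a i) = (\<Sum>i\<in>I. (c i * complex_of_real (weight i)) *\<^sub>C a i)"
proof -
  have "ensemble_operator a (\<Sum>i\<in>I. c i *\<^sub>C a i) =
      (\<Sum>i\<in>UNIV. if i \<in> I then (c i * complex_of_real (weight i)) *\<^sub>C a i else 0)"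
    unfolding ensemble_operator_def cinner_a_sum by (intro sum.cong) auto
  then show ?thesis by (simp add: sum.If_cases)
qed

lemma eigenspace_iff:
  assumes "\<mu> > 0"
  shows "x \<in> eigenspace (ensemble_operator a) \<mu> \<longleftrightarrow> component \<mu> x = x"
proof
  assume "x \<in> eigenspace (ensemble_operator a) \<mu>"
  then have ev: "ensemble_operator a x = complex_of_real \<mu> *\<^sub>C x"
    by (simp add: eigenspace_def)
  \<comment> \<open>Pairing the eigenvalue equation with \<open>a j\<close> multiplies
    \<open>cinner (a j) x\<close> by \<open>\<mu>\<close> on one side and by \<open>weight j\<close>
    on the other.\<close>
  have zero: "cinner (a j) x = 0" if "weight j \<noteq> \<mu>" for j
  proof -
    have "complex_of_real \<mu> * cinner (a j) x = cinner (a j) x * complex_of_real (weight j)"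
      using arg_cong[OF ev, of "cinner (a j)"]
      by (auto simp: ensemble_operator_def cinner_a_sum cinner_scaleC_right)
    then show ?thesis
      using that by auto
  qed
  have "complex_of_real \<mu> *\<^sub>C component \<mu> x = (\<Sum>i | weight i = \<mu>. cinner (a i) x *\<^sub>C a i)"
    using assms by (simp add: component_def complex_vector.scale_sum_right scaleC_scaleC)
  also have "\<dots> = ensemble_operator a x"
    unfolding ensemble_operator_def by (rule sum.mono_neutral_left) (auto simp: zero)
  also note ev
  finally show "component \<mu> x = x"
    using assms by simp
next
  assume *: "component \<mu> x = x"
  have "ensemble_operator a (component \<mu> x) = complex_of_real \<mu> *\<^sub>C component \<mu> x"
    unfolding component_def ensemble_operator_sum complex_vector.scale_sum_right scaleC_scaleC
    by (intro sum.cong) (auto simp: mult.commute)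
  with * show "x \<in> eigenspace (ensemble_operator a) \<mu>"
    by (simp add: eigenspace_def)
qed

lemma cinner_component: 
  assumes "\<mu> > 0" "weight j = \<mu>"
  shows "cinner (a j) (component \<mu> x) = cinner (a j) x"
  using assms by (simp add: component_def cinner_a_sum)

lemma component_in_eigenspace:
  assumes "\<mu> > 0"
  shows "component \<mu> x \<in> eigenspace (ensemble_operator a) \<mu>"
  unfolding eigenspace_iff[OF assms]
  by (subst (1 2) component_def) (simp add: cinner_component assms)

lemma eigenspace_eq_span:
  assumes "\<mu> > 0"
  shows "eigenspace (ensemble_operator a) \<mu> = complex_vector.span (a ` {i. weight i = \<mu>})"
proof
  show "eigenspace (ensemble_operator a) \<mu> \<subseteq> complex_vector.span (a ` {i. weight i = \<mu>})"
  proof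
    fix x assume "x \<in> eigenspace (ensemble_operator a) \<mu>"
    then have "x = component \<mu> x"
      by (simp add: eigenspace_iff[OF assms])
    moreover have "component \<mu> x \<in> complex_vector.span (a ` {i. weight i = \<mu>})"
      unfolding component_def
      by (intro complex_vector.span_sum complex_vector.span_scale complex_vector.span_base) auto
    ultimately show "x \<in> complex_vector.span (a ` {i. weight i = \<mu>})"
      by simp
  qed
  have "complex_vector.subspace (eigenspace (ensemble_operator a) \<mu>)"
    by (simp add: complex_vector.subspace_def eigenspace_def ensemble_operator_add
        ensemble_operator_scaleC scaleC_add_right mult.commute)
       (simp add: ensemble_operator_def)
  moreover have "a j \<in> eigenspace (ensemble_operator a) \<mu>" if "weight j = \<mu>" for j
    using ensemble_operator_sum[of "\<lambda>_. 1" "{j}"] that by (simp add: eigenspace_def scaleC_one)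
  ultimately show "complex_vector.span (a ` {i. weight i = \<mu>}) \<subseteq> eigenspace (ensemble_operator a) \<mu>"
    by (intro complex_vector.span_minimal) auto
qed

lemma dim_eigenspace:
  assumes "\<mu> > 0"
  shows "complex_vector.dim (eigenspace (ensemble_operator a) \<mu>) = card {i. weight i = \<mu>}"
proof -
  let ?I = "{i. weight i = \<mu>}"
  \<comment> \<open>Equal vectors at different indices would be orthogonal to themselves, against
    \<open>\<mu> > 0\<close>; so counting indices counts vectors.\<close>
  have inj: "inj_on a ?I"
  proof (rule inj_onI)
    fix i j assume "i \<in> ?I" "j \<in> ?I" "a i = a j"
    then show "i = j"
      using cinner_a[of i j] cinner_a[of i i] assms by (auto split: if_splits)
  qed
  have "\<not> complex_vector.dependent (a ` ?I)"
  proof -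
    have "u (a j) = 0" if 0: "(\<Sum>v\<in>a ` ?I. u v *\<^sub>C v) = 0" and j: "j \<in> ?I" for u j
    proof -
      have "cinner (a j) (\<Sum>i\<in>?I. u (a i) *\<^sub>C a i) = 0"
        using 0 by (simp add: sum.reindex[OF inj])
      then show ?thesis
        using j assms by (simp add: cinner_a_sum)
    qed
    then show ?thesis
      by (subst complex_vector.dependent_finite) auto
  qed
  then show ?thesis
    by (simp add: eigenspace_eq_span[OF assms] complex_vector.dim_eq_card_independent
        card_image[OF inj])
qed

lemma entanglement_spectrum_eq:
  "entanglement_spectrum (ensemble_operator a) \<mu> = (if 0 < \<mu> then card {i. weight i = \<mu>} else 0)"
  by (simp add: entanglement_spectrum_def dim_eigenspace)

lemma orthogonal_projection_eigenspace:
  assumes "\<mu> > 0"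
  shows "orthogonal_projection (eigenspace (ensemble_operator a) \<mu>) x = component \<mu> x"
  unfolding orthogonal_projection_def
proof (rule the_equality)
  let ?M = "eigenspace (ensemble_operator a) \<mu>"
  have orth: "cinner m (x - component \<mu> x) = 0" if "m \<in> ?M" for m
  proof -
    have "m = component \<mu> m"
      using that by (simp add: eigenspace_iff[OF assms])
    then have "cinner m (x - component \<mu> x) = cinner (component \<mu> m) (x - component \<mu> x)"
      by simp
    also have "\<dots> = 0"
      unfolding component_def[of \<mu> m] cinner_sum_left
      by (intro sum.neutral)
         (auto simp: cinner_scaleC_left cinner_diff_right cinner_component[OF assms])
    finally show ?thesis .
  qed
  then show "component \<mu> x \<in> ?M \<and> (\<forall>m\<in>?M. cinner m (x - component \<mu> x) = 0)"
    using component_in_eigenspace[OF assms] by blast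
  fix p assume p: "p \<in> ?M \<and> (\<forall>m\<in>?M. cinner m (x - p) = 0)"
  have d: "component \<mu> x - p \<in> ?M"
    using p component_in_eigenspace[OF assms, of x] unfolding eigenspace_eq_span[OF assms]
    by (auto intro: complex_vector.span_diff)
  \<comment> \<open>The difference of two candidates lies in the eigenspace and is a difference of
    residuals orthogonal to it, so it is orthogonal to itself.\<close>
  have "cinner (component \<mu> x - p) (component \<mu> x - p) =
      cinner (component \<mu> x - p) ((x - p) - (x - component \<mu> x))"
    by simp
  also have "\<dots> = 0"
    unfolding cinner_diff_right[of _ "x - p"] using p d orth[OF d] by simp
  finally show "p = component \<mu> x" by simp
qed

text \<open>The sum over eigenvalues is regrouped into a sum over indices. The exponent drops to
  \<open>\<alpha> - 1\<close> because of the division by \<open>\<mu>\<close> in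
  \<open>component\<close>.\<close>

lemma op_powr_eq:
  "op_powr (ensemble_operator a) \<alpha> =
    (\<lambda>x. \<Sum>i\<in>UNIV. (complex_of_real (weight i powr (\<alpha> - 1)) * cinner (a i) x) *\<^sub>C a i)"
proof
  fix x
  let ?f = "\<lambda>i. (complex_of_real (weight i powr (\<alpha> - 1)) * cinner (a i) x) *\<^sub>C a i"
  let ?S = "{\<mu>. 0 < \<mu> \<and> eigenspace (ensemble_operator a) \<mu> \<noteq> {0}}"
  \<comment> \<open>The positive eigenvalues are the weights of the nonzero vectors; they are
    finitely many, so the infinite sum is a finite one.\<close>
  have ev: "?S = weight ` {i. a i \<noteq> 0}"
  proof (intro equalityI subsetI)
    fix \<mu> assume \<mu>: "\<mu> \<in> ?S"
    then have "\<exists>i. weight i = \<mu>"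
      using eigenspace_eq_span[of \<mu>] by (cases "{i. weight i = \<mu>} = {}") auto
    then show "\<mu> \<in> weight ` {i. a i \<noteq> 0}"
      using \<mu> by (auto simp: weight_def)
  next
    fix \<mu> assume "\<mu> \<in> weight ` {i. a i \<noteq> 0}"
    then obtain i where i: "a i \<noteq> 0" "\<mu> = weight i" by blast
    then have "\<mu> > 0" by (simp add: weight_def)
    moreover have "a i \<in> eigenspace (ensemble_operator a) \<mu>"
      unfolding eigenspace_eq_span[OF \<open>\<mu> > 0\<close>] using i by (intro complex_vector.span_base) auto
    ultimately show "\<mu> \<in> ?S" using i by auto
  qed
  have "op_powr (ensemble_operator a) \<alpha> x =
      (\<Sum>\<mu>\<in>weight ` {i. a i \<noteq> 0}. complex_of_real (\<mu> powr \<alpha>) *\<^sub>C component \<mu> x)"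
    unfolding op_powr_def ev
    by (subst infsum_finite) (auto intro!: sum.cong simp: orthogonal_projection_eigenspace weight_def)
  also have "\<dots> = (\<Sum>\<mu>\<in>weight ` {i. a i \<noteq> 0}. \<Sum>i\<in>{i\<in>{i. a i \<noteq> 0}. weight i = \<mu>}. ?f i)"
  proof (rule sum.cong[OF refl])
    fix \<mu> assume "\<mu> \<in> weight ` {i. a i \<noteq> 0}"
    then have \<mu>: "\<mu> > 0" by (auto simp: weight_def)
    then have "{i. weight i = \<mu>} = {i\<in>{i. a i \<noteq> 0}. weight i = \<mu>}"
      by (auto simp: weight_def)
    then show "complex_of_real (\<mu> powr \<alpha>) *\<^sub>C component \<mu> x = (\<Sum>i\<in>{i\<in>{i. a i \<noteq> 0}. weight i = \<mu>}. ?f i)"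
      using \<mu> unfolding component_def complex_vector.scale_sum_right
      by (intro sum.cong) (auto simp: scaleC_scaleC powr_diff)
  qed
  also have "\<dots> = (\<Sum>i | a i \<noteq> 0. ?f i)"
    by (rule sum.image_gen[symmetric]) simp
  also have "\<dots> = (\<Sum>i\<in>UNIV. ?f i)"
    by (rule sum.mono_neutral_left) auto
  finally show "op_powr (ensemble_operator a) \<alpha> x = (\<Sum>i\<in>UNIV. ?f i)" .
qed

lemma renyi_entropy_eq:
  "renyi_entropy \<alpha> (ensemble_operator a) = 1 / (1 - \<alpha>) * ln (\<Sum>i\<in>UNIV. weight i powr \<alpha>)"
proof -
  \<comment> \<open>Zero weights need a separate case; there both sides vanish, as
    \<open>0 powr \<alpha>\<close> is 0.\<close>
  have "weight i powr (\<alpha> - 1) * weight i = weight i powr \<alpha>" for i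
    by (cases "weight i = 0") (simp_all add: weight_def powr_diff)
  moreover have "trace (op_powr (ensemble_operator a) \<alpha>) =
      complex_of_real (\<Sum>i\<in>UNIV. weight i powr (\<alpha> - 1) * weight i)"
    by (simp add: op_powr_eq trace_rank_one_sum cinner_a)
  ultimately show ?thesis
    by (simp add: renyi_entropy_def del: of_real_sum)
qed

end

section \<open>Multiplicities from power sums\<close>

text \<open>The polynomial \<open>z\<^sup>2 \<Prod>\<^sub>\<nu> (z - \<nu>)\<close>, over all other values \<open>\<nu>\<close> of \<open>p\<close> and \<open>q\<close>, isolates \<open>\<mu>\<close>; the
  factor \<open>z\<^sup>2\<close> means that no power sum of order 0 or 1 is needed.\<close>

lemma card_eq_if_power_sums_eq:
  fixes p q :: "'i::finite \<Rightarrow> real"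
  assumes sums: "\<And>n. n \<ge> 2 \<Longrightarrow> (\<Sum>i\<in>UNIV. p i ^ n) = (\<Sum>i\<in>UNIV. q i ^ n)"
    and "\<mu> \<noteq> 0"
  shows "card {i. p i = \<mu>} = card {i. q i = \<mu>}"
proof -
  define N where "N = (range p \<union> range q) - {\<mu>}"
  define Q where "Q = (\<Prod>\<nu>\<in>N. [:- \<nu>, 1:])"
  have Q: "poly Q z = (\<Prod>\<nu>\<in>N. z - \<nu>)" for z
    by (simp add: Q_def poly_prod)
  define f where "f z = z ^ 2 * poly Q z" for z
  have f0: "f z = 0" if "z \<in> N" for z
    using that by (auto simp: f_def Q N_def)
  have "f \<mu> \<noteq> 0"
    using assms(2) by (simp add: f_def Q N_def)
  have count: "(\<Sum>i\<in>UNIV. f (r i)) = card {i. r i = \<mu>} * f \<mu>" if "range r \<subseteq> insert \<mu> N"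
    for r :: "'i \<Rightarrow> real"
  proof -
    have "(\<Sum>i\<in>UNIV. f (r i)) = (\<Sum>i\<in>UNIV. if r i = \<mu> then f \<mu> else 0)"
      using that f0 by (intro sum.cong) auto
    then show ?thesis
      by (simp add: sum.If_cases)
  qed
  have f: "f z = (\<Sum>k\<le>degree Q. coeff Q k * z ^ (k + 2))" for z
    by (simp add: f_def poly_altdef sum_distrib_left power_add power2_eq_square ac_simps)
  have "(\<Sum>i\<in>UNIV. f (p i)) = (\<Sum>k\<le>degree Q. coeff Q k * (\<Sum>i\<in>UNIV. p i ^ (k + 2)))"
    unfolding f sum_distrib_left by (rule sum.swap)
  also have "\<dots> = (\<Sum>k\<le>degree Q. coeff Q k * (\<Sum>i\<in>UNIV. q i ^ (k + 2)))"
    by (simp only: sums le_add2)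
  also have "\<dots> = (\<Sum>i\<in>UNIV. f (q i))"
    unfolding f sum_distrib_left by (rule sum.swap)
  finally show ?thesis
    using \<open>f \<mu> \<noteq> 0\<close> by (simp add: count N_def image_subset_iff)
qed

text \<open>The fibre over the exceptional value is the complement of all the others, so its size
  agrees too. The exceptional value will be weight 0, which the positive spectrum does not
  see.\<close>

lemma ex_permutation_if_card_fibres_eq:
  fixes p q :: "'i::finite \<Rightarrow> 'b"
  assumes ne: "\<And>v. v \<noteq> v\<^sub>0 \<Longrightarrow> card {i. p i = v} = card {i. q i = v}"
  obtains \<pi> where "bij \<pi>" "\<And>i. q (\<pi> i) = p i"
proof -
  define V where "V = (range p \<union> range q) - {v\<^sub>0}"
  have count: "CARD('i) = card {i. r i = v\<^sub>0} + (\<Sum>v\<in>V. card {i. r i = v})"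
    if "range r \<subseteq> insert v\<^sub>0 V" for r :: "'i \<Rightarrow> 'b"
  proof -
    have "UNIV = (\<Union>v\<in>insert v\<^sub>0 V. {i. r i = v})"
      using that by auto
    also have "card \<dots> = (\<Sum>v\<in>insert v\<^sub>0 V. card {i. r i = v})"
      by (intro card_UN_disjoint) (auto simp: V_def)
    also have "\<dots> = card {i. r i = v\<^sub>0} + (\<Sum>v\<in>V. card {i. r i = v})"
      by (intro sum.insert) (auto simp: V_def)
    finally show ?thesis .
  qed
  have "(\<Sum>v\<in>V. card {i. p i = v}) = (\<Sum>v\<in>V. card {i. q i = v})"
    by (intro sum.cong ne) (auto simp: V_def)
  moreover have "range p \<subseteq> insert v\<^sub>0 V" "range q \<subseteq> insert v\<^sub>0 V"
    by (auto simp: V_def)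
  ultimately have "card {i. p i = v\<^sub>0} = card {i. q i = v\<^sub>0}"
    using count[of p] count[of q] by simp
  with ne have all: "card {i. p i = v} = card {i. q i = v}" for v
    by (cases "v = v\<^sub>0") auto
  have "\<exists>h. bij_betw h {i. p i = v} {i. q i = v}" for v
    by (intro finite_same_card_bij) (auto simp: all)
  then obtain h where h: "\<And>v. bij_betw (h v) {i. p i = v} {i. q i = v}"
    by metis
  define \<pi> where "\<pi> i = h (p i) i" for i
  have q: "q (\<pi> i) = p i" for i
    using bij_betwE[OF h[of "p i"]] by (simp add: \<pi>_def)
  have "inj \<pi>"
  proof (rule injI)
    fix i j assume ij: "\<pi> i = \<pi> j"
    then have "p i = p j" by (metis q)
    then show "i = j"
      using ij inj_onD[OF bij_betw_imp_inj_on[OF h[of "p i"]], of i j] by (simp add: \<pi>_def)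
  qed
  then have "bij \<pi>"
    by (simp add: bij_def finite_UNIV_inj_surj)
  from this q show ?thesis by (rule that)
qed

section \<open>Schmidt decompositions and bilocal unitaries\<close>

lemma ex_schmidt_decomposition:
  fixes \<Psi> :: "'s::complex_hilbert_space ^ 'g::finite"
  obtains Y :: "complex ^ 'g \<Rightarrow> complex ^ 'g" and a where "unitary Y" "orthogonal_family a"
    "\<Psi> = (\<Sum>g\<in>UNIV. tensor_vec (Y (ket g)) (a g))"
proof -
  obtain Y :: "complex ^ 'g \<Rightarrow> complex ^ 'g" where Y: "unitary Y"
    "\<And>g h. g \<noteq> h \<Longrightarrow> cinner (bra_apply (Y (ket g)) \<Psi>) (bra_apply (Y (ket h)) \<Psi>) = 0"
    using ex_schmidt_basis by blast
  show ?thesis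
    by (rule that[OF Y(1) _ bra_apply_expansion[OF Y(1)]]) (simp add: orthogonal_family_def Y(2))
qed

text \<open>A permutation \<open>\<pi>\<close> matches the norms. One unitary then takes
  \<open>a g\<close> to \<open>b (\<pi> g)\<close>, another takes \<open>Y (ket g)\<close> to
  \<open>W (ket (\<pi> g))\<close>, and reindexing by \<open>\<pi>\<close> restores the
  target.\<close>

lemma ex_bilocal_unitary_mapping:
  fixes a b :: "'g::finite \<Rightarrow> 's::complex_hilbert_space"
    and Y W :: "complex ^ 'g \<Rightarrow> complex ^ 'g"
  assumes a: "orthogonal_family a" and b: "orthogonal_family b"
    and Y: "unitary Y" and W: "unitary W"
    and card: "\<And>\<mu>. \<mu> > 0 \<Longrightarrow> card {g. (norm (a g))\<^sup>2 = \<mu>} = card {g. (norm (b g))\<^sup>2 = \<mu>}"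
  obtains X where "bilocal_unitary X"
    "X (\<Sum>g\<in>UNIV. tensor_vec (Y (ket g)) (a g)) = (\<Sum>g\<in>UNIV. tensor_vec (W (ket g)) (b g))"
proof -
  have fibres: "card {g. (norm (a g))\<^sup>2 = v} = card {g. (norm (b g))\<^sup>2 = v}" if "v \<noteq> 0" for v
  proof (cases "v > 0")
    case False
    then have "{g. (norm (c g))\<^sup>2 = v} = {}" for c :: "'g \<Rightarrow> 's"
      using that by auto
    then show ?thesis by simp
  qed (rule card)
  obtain \<pi> where "bij \<pi>" "\<And>g. (norm (b (\<pi> g)))\<^sup>2 = (norm (a g))\<^sup>2"
    using ex_permutation_if_card_fibres_eq[OF fibres] by blast
  then have \<pi>: "bij \<pi>" "\<And>g. norm (b (\<pi> g)) = norm (a g)"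
    by simp_all
  have inj: "\<pi> g = \<pi> h \<longleftrightarrow> g = h" for g h
    using \<pi>(1) by (simp add: bij_def inj_eq)
  obtain Z where Z: "unitary Z" "\<And>g. Z (a g) = b (\<pi> g)"
    using ex_unitary_mapping_family[of a "\<lambda>g. b (\<pi> g)"]
    by (metis a b inj orthogonal_family_def \<pi>(2))
  obtain V where V: "unitary V" "\<And>g. V (Y (ket g)) = W (ket (\<pi> g))"
    using ex_unitary_mapping_family[of "\<lambda>g. Y (ket g)" "\<lambda>g. W (ket (\<pi> g))"]
    by (simp add: unitary_cinner[OF Y] unitary_cinner[OF W] cinner_ket_ket inj
        unitary_norm[OF Y] unitary_norm[OF W]) metis
  have "tensor_op V Z (\<Sum>g\<in>UNIV. tensor_vec (Y (ket g)) (a g)) =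
      (\<Sum>g\<in>UNIV. tensor_vec (W (ket (\<pi> g))) (b (\<pi> g)))"
    by (simp add: tensor_op_sum[OF Z(1)] tensor_op_tensor_vec unitary_bounded_clinear V Z)
  also have "\<dots> = (\<Sum>g\<in>UNIV. tensor_vec (W (ket g)) (b g))"
    by (rule sum.reindex_bij_betw) (rule \<pi>(1))
  finally show ?thesis
    using V(1) Z(1) by (intro that[of "tensor_op V Z"]) (auto simp: bilocal_unitary_def)
qed

lemma mem_tps_invariant_subalgebra_iff:
  assumes "unitary_representation U" and X: "unitary X"
  shows "ketbra \<psi> \<psi> \<in> tps_invariant_subalgebra U g\<^sub>i g\<^sub>j X \<longleftrightarrow>
    ketbra (frame_change U g\<^sub>i g\<^sub>j \<psi>) (frame_change U g\<^sub>i g\<^sub>j \<psi>) = ketbra (inv X \<psi>) (inv X \<psi>)"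
proof -
  \<comment> \<open>Conjugation by the adjoint is treated as conjugation by the unitary
    \<open>inv X\<close>, whose inverse is \<open>X\<close>.\<close>
  have "inv (inv X) = X"
    using X by (intro inv_inv_eq) (simp add: bij_def unitary_inj unitary_surj)
  then have "cadjoint X \<circ> ketbra \<psi> \<psi> \<circ> X = ketbra (inv X \<psi>) (inv X \<psi>)"
    using conjugate_ketbra[OF unitary_inv[OF X], of \<psi> \<psi>] by (simp add: cadjoint_unitary[OF X])
  then show ?thesis
    using conjugate_ketbra[OF unitary_frame_change[OF assms(1)]]
    by (simp add: tps_invariant_subalgebra_def bounded_clinear_ketbra conjugate_by_def
        frame_unitary_eq_frame_change cadjoint_unitary[OF unitary_frame_change[OF assms(1)]])
qed

lemma bilocal_unitary_unitary: "bilocal_unitary X \<Longrightarrow> unitary X"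
  by (auto simp: bilocal_unitary_def unitary_tensor_op)

text \<open>A bilocal unitary maps a Schmidt decomposition to a Schmidt decomposition and keeps the
  norms.\<close>

lemma partial_trace_bilocal_unitary:
  fixes \<psi> :: "'s::complex_hilbert_space ^ 'g::finite"
  assumes "bilocal_unitary X"
  obtains a b :: "'g \<Rightarrow> 's" where "orthogonal_family a" "orthogonal_family b"
    "\<And>g. norm (a g) = norm (b g)"
    "partial_trace (ketbra \<psi> \<psi>) = ensemble_operator a"
    "partial_trace (ketbra (X \<psi>) (X \<psi>)) = ensemble_operator b"
proof -
  obtain V Z where V: "unitary V" and Z: "unitary Z" and X: "X = tensor_op V Z"
    using assms by (auto simp: bilocal_unitary_def)
  obtain Y :: "complex ^ 'g \<Rightarrow> complex ^ 'g" and a where Y: "unitary Y"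
    and a: "orthogonal_family a" and \<psi>: "\<psi> = (\<Sum>g\<in>UNIV. tensor_vec (Y (ket g)) (a g))"
    by (rule ex_schmidt_decomposition)
  have "X \<psi> = (\<Sum>g\<in>UNIV. tensor_vec ((V \<circ> Y) (ket g)) (Z (a g)))"
    by (simp add: X \<psi> tensor_op_sum[OF Z] tensor_op_tensor_vec unitary_bounded_clinear V Z)
  then have "partial_trace (ketbra (X \<psi>) (X \<psi>)) = ensemble_operator (\<lambda>g. Z (a g))"
    by (rule partial_trace_schmidt[OF unitary_comp[OF V Y]])
  moreover have "orthogonal_family (\<lambda>g. Z (a g))"
    using a by (simp add: orthogonal_family_def unitary_cinner[OF Z])
  ultimately show ?thesis
    using that[OF a _ _ partial_trace_schmidt[OF Y \<psi>]] by (simp add: unitary_norm[OF Z])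
qed

text \<open>A nonzero vector in each family makes the power sums positive, where \<open>ln\<close>
  is injective; \<open>\<alpha> \<noteq> 1\<close> lets the prefactor be cancelled.\<close>

lemma power_sums_eq_if_renyi_entropy_eq:
  fixes a b :: "'i::finite \<Rightarrow> 's::complex_hilbert_space"
  assumes a: "orthogonal_family a" and b: "orthogonal_family b"
    and "\<exists>i. a i \<noteq> 0" "\<exists>i. b i \<noteq> 0" and \<alpha>: "\<alpha> \<noteq> 1"
    and eq: "renyi_entropy \<alpha> (ensemble_operator a) = renyi_entropy \<alpha> (ensemble_operator b)"
  shows "(\<Sum>i\<in>UNIV. (norm (a i))\<^sup>2 powr \<alpha>) = (\<Sum>i\<in>UNIV. (norm (b i))\<^sup>2 powr \<alpha>)"
proof -
  have pos: "(\<Sum>i\<in>UNIV. (norm (c i))\<^sup>2 powr \<alpha>) > 0" if c: "\<exists>i. c i \<noteq> 0" for c :: "'i \<Rightarrow> 's"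
  proof -
    obtain i where "c i \<noteq> 0" using c by blast
    then show ?thesis by (intro sum_pos2[of UNIV i]) auto
  qed
  show ?thesis
    using eq \<alpha> pos[OF assms(3)] pos[OF assms(4)]
    by (simp add: orthogonal_family.renyi_entropy_eq[OF a] orthogonal_family.renyi_entropy_eq[OF b]
        orthogonal_family.weight_def[OF a] orthogonal_family.weight_def[OF b])
qed

theorem corollary5p1:
  fixes U :: "'g::{finite,ab_group_add} \<Rightarrow> 's::complex_hilbert_space \<Rightarrow> 's"
    and g\<^sub>i g\<^sub>j :: 'g
    and \<rho>\<^sub>i \<rho>\<^sub>j :: "('s, 'g) vec \<Rightarrow> ('s, 'g) vec"
  assumes "(UNIV :: 'g set) \<noteq> {0}"
    and "unitary_representation U"
    and "pure_state \<rho>\<^sub>i"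
    and "\<rho>\<^sub>j = conjugate_by (frame_change U g\<^sub>i g\<^sub>j) \<rho>\<^sub>i"
  shows "((\<forall>\<alpha>\<in>{0<..<1} \<union> {1<..}.
            renyi_entropy \<alpha> (partial_trace \<rho>\<^sub>i) = renyi_entropy \<alpha> (partial_trace \<rho>\<^sub>j))
          \<longleftrightarrow> (\<exists>X. bilocal_unitary X \<and> \<rho>\<^sub>i \<in> tps_invariant_subalgebra U g\<^sub>i g\<^sub>j X))
    \<and> (entanglement_spectrum (partial_trace \<rho>\<^sub>i) = entanglement_spectrum (partial_trace \<rho>\<^sub>j)
          \<longleftrightarrow> (\<exists>X. bilocal_unitary X \<and> \<rho>\<^sub>i \<in> tps_invariant_subalgebra U g\<^sub>i g\<^sub>j X))"
proof -
  obtain \<psi> where \<psi>: "norm \<psi> = 1" and \<rho>i: "\<rho>\<^sub>i = ketbra \<psi> \<psi>"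
    using assms(3) by (auto simp: pure_state_def)
  define F where "F = frame_change U g\<^sub>i g\<^sub>j"
  have F: "unitary F"
    unfolding F_def by (rule unitary_frame_change[OF assms(2)])
  have \<rho>j: "\<rho>\<^sub>j = ketbra (F \<psi>) (F \<psi>)"
    unfolding assms(4) \<rho>i F_def[symmetric] conjugate_by_def cadjoint_unitary[OF F]
    by (rule conjugate_ketbra[OF F])
  obtain Y :: "(complex, 'g) vec \<Rightarrow> (complex, 'g) vec" and a where Y: "unitary Y"
    and a: "orthogonal_family a" and \<psi>a: "\<psi> = (\<Sum>g\<in>UNIV. tensor_vec (Y (ket g)) (a g))"
    by (rule ex_schmidt_decomposition)
  obtain W :: "(complex, 'g) vec \<Rightarrow> (complex, 'g) vec" and b where W: "unitary W"
    and b: "orthogonal_family b" and \<psi>b: "F \<psi> = (\<Sum>g\<in>UNIV. tensor_vec (W (ket g)) (b g))"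
    by (rule ex_schmidt_decomposition)
  note pa = partial_trace_schmidt[OF Y \<psi>a] and pb = partial_trace_schmidt[OF W \<psi>b]
  let ?R = "\<forall>\<alpha>\<in>{0<..<1} \<union> {1<..}.
    renyi_entropy \<alpha> (partial_trace \<rho>\<^sub>i) = renyi_entropy \<alpha> (partial_trace \<rho>\<^sub>j)"
  let ?S = "entanglement_spectrum (partial_trace \<rho>\<^sub>i) = entanglement_spectrum (partial_trace \<rho>\<^sub>j)"
  let ?T = "\<exists>X. bilocal_unitary X \<and> \<rho>\<^sub>i \<in> tps_invariant_subalgebra U g\<^sub>i g\<^sub>j X"
  \<comment> \<open>Equal multiplicities of the positive weights are the common consequence of both
    criteria.\<close>
  have card_imp_T: ?T
    if card: "\<And>\<mu>. \<mu> > 0 \<Longrightarrow> card {g. (norm (a g))\<^sup>2 = \<mu>} = card {g. (norm (b g))\<^sup>2 = \<mu>}"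
  proof -
    \<comment> \<open>The direction is from \<open>F \<psi>\<close> back to \<open>\<psi>\<close>,
      because the subalgebra conjugates by the adjoint of \<open>X\<close>.\<close>
    obtain X where X: "bilocal_unitary X" "X (F \<psi>) = \<psi>"
      using ex_bilocal_unitary_mapping[OF b a W Y card[symmetric]]
      unfolding \<psi>a[symmetric] \<psi>b[symmetric] by blast
    then have "inv X \<psi> = F \<psi>"
      using unitary_inv_left[OF bilocal_unitary_unitary[OF X(1)], of "F \<psi>"] by simp
    with X(1) show ?thesis
      unfolding \<rho>i using mem_tps_invariant_subalgebra_iff[OF assms(2) bilocal_unitary_unitary[OF X(1)]]
      by (auto simp: F_def)
  qed
  have S_imp_T: ?T if ?S
  proof (rule card_imp_T)
    fix \<mu> :: real assume "\<mu> > 0"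
    then show "card {g. (norm (a g))\<^sup>2 = \<mu>} = card {g. (norm (b g))\<^sup>2 = \<mu>}"
      using fun_cong[OF that, of \<mu>] unfolding \<rho>i \<rho>j pa pb
      by (simp add: orthogonal_family.entanglement_spectrum_eq[OF a]
          orthogonal_family.entanglement_spectrum_eq[OF b]
          orthogonal_family.weight_def[OF a] orthogonal_family.weight_def[OF b])
  qed
  have R_imp_T: ?T if R: ?R
  proof (rule card_imp_T)
    have "\<psi> \<noteq> 0" "F \<psi> \<noteq> 0"
      using \<psi> unitary_norm[OF F, of \<psi>] by auto
    moreover have "(\<Sum>g\<in>UNIV. tensor_vec (V (ket g)) (c g)) = 0" if "\<nexists>g. c g \<noteq> 0"
      for V :: "(complex, 'g) vec \<Rightarrow> (complex, 'g) vec" and c :: "'g \<Rightarrow> 's"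
      using that by (simp add: vec_eq_iff)
    ultimately have ab: "\<exists>g. a g \<noteq> 0" "\<exists>g. b g \<noteq> 0"
      using \<psi>a \<psi>b by metis+
    fix \<mu> :: real assume "\<mu> > 0"
    \<comment> \<open>Only the integers \<open>n \<ge> 2\<close> are used, all of which are
      admissible values of \<open>\<alpha>\<close>.\<close>
    have "(\<Sum>g\<in>UNIV. ((norm (a g))\<^sup>2) ^ n) = (\<Sum>g\<in>UNIV. ((norm (b g))\<^sup>2) ^ n)" if "n \<ge> 2" for n
    proof -
      have pow: "(norm x)\<^sup>2 powr real n = ((norm x)\<^sup>2) ^ n" for x :: 's
        using that by (cases "x = 0") (simp_all add: powr_realpow)
      have "renyi_entropy (real n) (ensemble_operator a) = renyi_entropy (real n) (ensemble_operator b)"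
        using R that unfolding \<rho>i \<rho>j pa pb by auto
      from power_sums_eq_if_renyi_entropy_eq[OF a b ab _ this] show ?thesis
        using that by (simp add: pow)
    qed
    then show "card {g. (norm (a g))\<^sup>2 = \<mu>} = card {g. (norm (b g))\<^sup>2 = \<mu>}"
      using \<open>\<mu> > 0\<close> by (intro card_eq_if_power_sums_eq) auto
  qed
  have T_imp: "?R \<and> ?S" if T: ?T
  proof -
    obtain X where X: "bilocal_unitary X" and "\<rho>\<^sub>i \<in> tps_invariant_subalgebra U g\<^sub>i g\<^sub>j X"
      using T by blast
    then have \<rho>j': "\<rho>\<^sub>j = ketbra (inv X \<psi>) (inv X \<psi>)"
      unfolding \<rho>i \<rho>j F_def
      using mem_tps_invariant_subalgebra_iff[OF assms(2) bilocal_unitary_unitary[OF X]] by simp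
    \<comment> \<open>\<open>X\<close> sends \<open>inv X \<psi>\<close> to \<open>\<psi>\<close>,
      so \<open>c\<close> belongs to the reduced state of \<open>\<rho>\<^sub>j\<close> and
      \<open>d\<close> to that of \<open>\<rho>\<^sub>i\<close>.\<close>
    obtain c d :: "'g \<Rightarrow> 's" where c: "orthogonal_family c" and d: "orthogonal_family d"
      and norm: "\<And>g. norm (c g) = norm (d g)"
      and pc: "partial_trace \<rho>\<^sub>j = ensemble_operator c"
      and pd: "partial_trace \<rho>\<^sub>i = ensemble_operator d"
      using partial_trace_bilocal_unitary[OF X, of "inv X \<psi>"]
      unfolding \<rho>j' \<rho>i unitary_inv_right[OF bilocal_unitary_unitary[OF X]] by blast
    show ?thesis
      by (auto simp: fun_eq_iff pc pd norm orthogonal_family.renyi_entropy_eq[OF c]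
          orthogonal_family.renyi_entropy_eq[OF d]
          orthogonal_family.entanglement_spectrum_eq[OF c]
          orthogonal_family.entanglement_spectrum_eq[OF d]
          orthogonal_family.weight_def[OF c] orthogonal_family.weight_def[OF d])
  qed
  show ?thesis
    using S_imp_T R_imp_T T_imp by blast
qed

end
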